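(* Let $k\ge 3$ and $r\ge 1$, and let $n_1,\dots,n_r\ge 2$ be integers. For each $1\le i\le r$ let $\mathcal{F}^1_i,\dots,\mathcal{F}^k_i$ be pairwise almost orthogonal symmetric chain decompositions of $Q_{n_i}$. Suppose that the collection $\{\mathcal{F}^j_i\}_{j=1}^k$ is good for every $i$ with $n_i$ even, and that, among the indices $i$ with $n_i$ odd, either the collections $\{\mathcal{F}^j_i\}_{j=1}^k$ are good for all of them or they are good for at least two of them. Then there exist $k$ pairwise almost orthogonal symmetric chain decompositions $\mathcal{H}^1,\dots,\mathcal{H}^k$ of $Q_{n_1+\cdots+n_r}$ such that for each $j$, every chain of $\mathcal{H}^j$ is contained in a cuboid $A_1\times\cdots\times A_r$ with $A_i\in\mathcal{F}^j_i$ for all $i$ (i.e. $\mathcal{H}^j$ is obtained by decomposing each such cuboid into symmetric chains).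
   Context: $Q_n$ denotes the Boolean lattice of subsets of $[n]=\{1,\dots,n\}$ under inclusion. We identify $Q_{n_1}\times\cdots\times Q_{n_r}$ (product order) with $Q_{n_1+\cdots+n_r}$ by splitting $[n_1+\cdots+n_r]$ into consecutive blocks of sizes $n_1,\dots,n_r$. A symmetric chain in $Q_n$ consists of exactly one subset of each size $j,j+1,\dots,n-j$ for some $j$; a symmetric chain decomposition (SCD) is a partition of $Q_n$ into symmetric chains. Two SCDs $\mathcal{F},\mathcal{G}$ of $Q_n$ are almost orthogonal if for all chains $A\in\mathcal{F}$, $B\in\mathcal{G}$, $|A\cap B|\le1$, except when $A$ and $B$ both contain $\varnothing$ and $[n]$, in which case $|A\cap B|=2$. A collection $\{\mathcal{F}^j\}$ of pairwise almost orthogonal SCDs of $Q_n$ is good if either $n$ is even and the $1$-element chains occurring in the different $\mathcal{F}^j$ are pairwise distinct (no $1$-element chain belongs to two different $\mathcal{F}^j$), or $n$ is odd and the graph whose vertex set is the union of all $2$-element chains of all $\mathcal{F}^j$ and whose edges are these $2$-element chains admits an orientation of its edges in which every vertex has out-degree at most $1$. *)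

theory Defs
  imports "HOL-Library.Disjoint_Sets" "HOL-Library.FuncSet"
begin

definition boolean_lattice :: "nat \<Rightarrow> nat set set" where
  "boolean_lattice n = Pow {1..n}"

definition symmetric_chain :: "nat \<Rightarrow> nat set set \<Rightarrow> bool" where
  "symmetric_chain n C \<longleftrightarrow>
     C \<subseteq> boolean_lattice n \<and> chain_subset C \<and>
     (\<exists>j. 2 * j \<le> n \<and> bij_betw card C {j..n - j})"

definition SCD :: "nat \<Rightarrow> nat set set set \<Rightarrow> bool" where
  "SCD n F \<longleftrightarrow> partition_on (boolean_lattice n) F \<and> (\<forall>C\<in>F. symmetric_chain n C)"

definition almost_orthogonal :: "nat \<Rightarrow> nat set set set \<Rightarrow> nat set set set \<Rightarrow> bool" where
  "almost_orthogonal n F G \<longleftrightarrow>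
     (\<forall>A\<in>F. \<forall>B\<in>G.
        if {{}, {1..n}} \<subseteq> A \<and> {{}, {1..n}} \<subseteq> B
        then card (A \<inter> B) = 2
        else card (A \<inter> B) \<le> 1)"

definition pairwise_almost_orthogonal_SCDs ::
    "nat \<Rightarrow> nat \<Rightarrow> (nat \<Rightarrow> nat set set set) \<Rightarrow> bool" where
  "pairwise_almost_orthogonal_SCDs n k F \<longleftrightarrow>
     (\<forall>j\<in>{1..k}. SCD n (F j)) \<and>
     (\<forall>j\<in>{1..k}. \<forall>j'\<in>{1..k}. j \<noteq> j' \<longrightarrow> almost_orthogonal n (F j) (F j'))"

(* D contains exactly one of the arcs (u, v), (v, u) for every edge {u, v} in E, and no
   other arcs. Meant for sets E of 2-element edges. *)
definition orientation :: "'v set set \<Rightarrow> ('v \<times> 'v) set \<Rightarrow> bool" where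
  "orientation E D \<longleftrightarrow> bij_betw (\<lambda>(u, v). {u, v}) D E"

definition two_element_chains :: "nat \<Rightarrow> (nat \<Rightarrow> nat set set set) \<Rightarrow> nat set set set" where
  "two_element_chains k F = (\<Union>j\<in>{1..k}. {C \<in> F j. card C = 2})"

(* Only used for families satisfying pairwise_almost_orthogonal_SCDs n k F.
   The out-degree of v in the arc set D is card (D `` {v}). *)
definition good :: "nat \<Rightarrow> nat \<Rightarrow> (nat \<Rightarrow> nat set set set) \<Rightarrow> bool" where
  "good n k F \<longleftrightarrow>
     (even n \<and> disjoint_family_on (\<lambda>j. {C \<in> F j. card C = 1}) {1..k}) \<or>
     (odd n \<and>
      (\<exists>D. orientation (two_element_chains k F) D \<and>
           (\<forall>v\<in>\<Union>(two_element_chains k F). card (D `` {v}) \<le> 1)))"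

(* The identification of the product of the Q_{n i}, i = 1, ..., r, with Q_{n 1 + ... + n r}:
   the i-th component is shifted into the i-th consecutive block. *)
definition join_blocks :: "nat \<Rightarrow> (nat \<Rightarrow> nat) \<Rightarrow> (nat \<Rightarrow> nat set) \<Rightarrow> nat set" where
  "join_blocks r n S = (\<Union>i\<in>{1..r}. (\<lambda>x. (\<Sum>l\<in>{1..<i}. n l) + x) ` S i)"

definition cuboid :: "nat \<Rightarrow> (nat \<Rightarrow> nat) \<Rightarrow> (nat \<Rightarrow> nat set set) \<Rightarrow> nat set set" where
  "cuboid r n A = join_blocks r n ` (\<Pi>\<^sub>E i\<in>{1..r}. A i)"

end

theory Submission
  imports Defs
begin

text \<open>
  The \<open>j\<close>-th decomposition consists of the cuboids \<open>A\<^sub>1 \<times> \<dots> \<times> A\<^sub>r\<close> with \<open>A\<^sub>i \<in> \<F>\<^sub>i\<^sup>j\<close>, each of which has to be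
  cut into symmetric chains. Two cuboids of different colours meet in several points only if some
  factors are full chains (those containing \<open>\<emptyset>\<close> and \<open>[n\<^sub>i]\<close>) in both colours, and two common points
  \<open>X \<subset> Y\<close> then run from bottom to top on a nonempty set \<open>I\<close> of these factors and agree on the
  others: a clash. Let \<open>M\<close> be the set of full factors of a cuboid. Every cuboid has a symmetric chain
  decomposition without clashes inside a chain, apart from two unavoidable kinds, both with \<open>I = M\<close>:
  either all factors outside \<open>M\<close> are singletons, or \<open>M\<close> has one element and all other factors have at
  most two elements, some having two. In the second case the clashes can be confined to one end of
  a 2-element factor in an odd good collection. If a clash occurs in two colours, then in the first case
  two colours share a 1-element chain unless \<open>X\<close> and \<open>Y\<close> are the extreme points of the whole cube;
  in the second case two edges leave the same vertex in the orientation.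

  The decompositions are found in products of two coordinates at a time, and they need every full chain
  to have at least 5 elements. This is where \<open>k \<ge> 3\<close> enters: a set of size \<open>p < n / 2\<close> has pairwise
  different successors in \<open>k\<close> almost orthogonal decompositions, hence \<open>n - p \<ge> k\<close>, which fails for
  \<open>n = 2\<close>, \<open>p = 0\<close> and for \<open>n = 3\<close>, \<open>p = 1\<close>.
\<close>

section \<open>Symmetric chain decompositions of boxes\<close>

text \<open>Points are total functions that vanish off \<open>K\<close>, so that the pointwise order
  on functions is the product order of the chains.\<close>

definition box :: "nat set \<Rightarrow> (nat \<Rightarrow> nat) \<Rightarrow> (nat \<Rightarrow> nat) set" where
  "box K b = {z. (\<forall>i\<in>K. z i \<le> b i) \<and> (\<forall>i. i \<notin> K \<longrightarrow> z i = 0)}"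

definition box_chain :: "nat set \<Rightarrow> (nat \<Rightarrow> nat) \<Rightarrow> (nat \<Rightarrow> nat) set \<Rightarrow> bool" where
  "box_chain K b C \<longleftrightarrow> (\<forall>x\<in>C. \<forall>y\<in>C. x \<le> y \<or> y \<le> x) \<and>
     (\<exists>j. 2 * j \<le> sum b K \<and> bij_betw (\<lambda>z. sum z K) C {j..sum b K - j})"

text \<open>Symmetry refers to the whole box even when \<open>X\<close> is only a region of it, so
  decompositions of disjoint regions can be united. \<open>R\<close> holds the pairs that may not
  share a chain.\<close>

definition avoiding_scd ::
    "nat set \<Rightarrow> (nat \<Rightarrow> nat) \<Rightarrow> ((nat \<Rightarrow> nat) \<Rightarrow> (nat \<Rightarrow> nat) \<Rightarrow> bool) \<Rightarrow> (nat \<Rightarrow> nat) set \<Rightarrow> bool"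
where
  "avoiding_scd K b R X \<longleftrightarrow> (\<exists>P. partition_on X P \<and>
     (\<forall>C\<in>P. box_chain K b C \<and> (\<forall>x\<in>C. \<forall>y\<in>C. \<not> R x y)))"

lemma avoiding_scd_Un:
  assumes "avoiding_scd K b R X" "avoiding_scd K b R Y" "X \<inter> Y = {}"
  shows "avoiding_scd K b R (X \<union> Y)"
proof -
  obtain P where P: "partition_on X P"
    "\<forall>C\<in>P. box_chain K b C \<and> (\<forall>x\<in>C. \<forall>y\<in>C. \<not> R x y)"
    using assms(1) unfolding avoiding_scd_def by (elim exE conjE)
  obtain Q where Q: "partition_on Y Q"
    "\<forall>C\<in>Q. box_chain K b C \<and> (\<forall>x\<in>C. \<forall>y\<in>C. \<not> R x y)"
    using assms(2) unfolding avoiding_scd_def by (elim exE conjE)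
  from P Q show ?thesis
    unfolding avoiding_scd_def
    by (intro exI[of _ "P \<union> Q"] conjI)
      (use assms(3) in \<open>auto simp: partition_on_def intro!: disjoint_union\<close>)
qed

text \<open>A monotone map that raises every rank by \<open>d\<close> preserves chains; the equation
  \<open>2 * d + sum b' K' = sum b K\<close> says that the middle rank goes to the middle
  rank.\<close>

lemma avoiding_scd_image:
  assumes inj: "inj_on f X"
    and mono: "\<And>x y. x \<in> X \<Longrightarrow> y \<in> X \<Longrightarrow> x \<le> y \<Longrightarrow> f x \<le> f y"
    and rank: "\<And>x. x \<in> X \<Longrightarrow> sum (f x) K = d + sum x K'"
    and sym: "2 * d + sum b' K' = sum b K"
    and scd: "avoiding_scd K' b' R' X"
    and R: "\<And>x y. x \<in> X \<Longrightarrow> y \<in> X \<Longrightarrow> R (f x) (f y) \<Longrightarrow> R' x y"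
  shows "avoiding_scd K b R (f ` X)"
proof -
  obtain P where P: "partition_on X P"
    and chains: "\<And>C. C \<in> P \<Longrightarrow> box_chain K' b' C"
    and R': "\<And>C x y. C \<in> P \<Longrightarrow> x \<in> C \<Longrightarrow> y \<in> C \<Longrightarrow> \<not> R' x y"
    using scd unfolding avoiding_scd_def by blast
  have sub: "C \<subseteq> X" if "C \<in> P" for C
    using P that by (auto simp: partition_on_def)
  have "box_chain K b (f ` C)" if C: "C \<in> P" for C
  proof -
    obtain j where j: "2 * j \<le> sum b' K'" "bij_betw (\<lambda>z. sum z K') C {j..sum b' K' - j}"
      using chains[OF C] by (auto simp: box_chain_def)
    have "bij_betw f C (f ` C)"
      using inj_on_subset[OF inj sub[OF that]] by (simp add: bij_betw_def)
    moreover have "bij_betw (\<lambda>z. sum (f z) K) C {d + j..sum b K - (d + j)}"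
    proof -
      have "bij_betw (\<lambda>t. d + t) {j..sum b' K' - j} {d + j..sum b K - (d + j)}"
        by (rule bij_betw_byWitness[where f' = "\<lambda>t. t - d"]) (use sym j in auto)
      from bij_betw_trans[OF j(2) this] have "bij_betw (\<lambda>z. d + sum z K') C {d + j..sum b K - (d + j)}"
        by (simp add: o_def)
      then show ?thesis
        by (rule bij_betw_cong[THEN iffD1, rotated]) (use rank sub[OF that] in force)
    qed
    ultimately have "bij_betw (\<lambda>z. sum z K) (f ` C) {d + j..sum b K - (d + j)}"
      unfolding bij_betw_def inj_on_def image_image by auto
    moreover have "2 * (d + j) \<le> sum b K"
      using j sym by simp
    moreover have "\<forall>x\<in>f ` C. \<forall>y\<in>f ` C. x \<le> y \<or> y \<le> x"
    proof (intro ballI)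
      fix x y assume "x \<in> f ` C" "y \<in> f ` C"
      then obtain v w where vw: "v \<in> C" "w \<in> C" "x = f v" "y = f w" by blast
      then have "v \<le> w \<or> w \<le> v"
        using chains[OF C] unfolding box_chain_def by blast
      then show "x \<le> y \<or> y \<le> x"
        using vw mono sub[OF C] by blast
    qed
    ultimately show ?thesis
      unfolding box_chain_def by blast
  qed
  moreover have "\<not> R x y" if "C \<in> P" "x \<in> f ` C" "y \<in> f ` C" for C x y
    using that R R' sub by blast
  moreover have "partition_on (f ` X) ((`) f ` P)"
    using partition_on_inj_image[OF P inj] partition_onD3[OF P] by (simp add: image_iff)
  ultimately show ?thesis
    unfolding avoiding_scd_def by blast
qed

text \<open>A symmetric saturated chain of a grid with sides \<open>a\<close> and \<open>b\<close>:
  \<open>Q\<close> is its set of points and \<open>(p t, q t)\<close> its point of rank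
  \<open>d + t\<close>. The last clause keeps other points out of \<open>Q\<close> and recovers the
  position from the rank.\<close>

definition grid_path ::
    "nat \<Rightarrow> nat \<Rightarrow> (nat \<Rightarrow> nat \<Rightarrow> bool) \<Rightarrow> (nat \<Rightarrow> nat) \<Rightarrow> (nat \<Rightarrow> nat) \<Rightarrow> nat \<Rightarrow> nat \<Rightarrow> bool" where
  "grid_path a b Q p q d l \<longleftrightarrow> 2 * d + l = a + b \<and>
     (\<forall>t\<le>l. Q (p t) (q t) \<and> p t + q t = d + t) \<and>
     (\<forall>s t. s \<le> t \<and> t \<le> l \<longrightarrow> p s \<le> p t \<and> q s \<le> q t) \<and>
     (\<forall>x y. Q x y \<longrightarrow> x \<le> a \<and> y \<le> b \<and> d \<le> x + y \<and> x + y \<le> d + l \<and>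
        p (x + y - d) = x \<and> q (x + y - d) = y)"

lemma sum_two:
  fixes f :: "nat \<Rightarrow> nat"
  assumes "finite K" "i \<in> K" "j \<in> K" "i \<noteq> j"
  shows "sum f K = f i + f j + sum f (K - {i} - {j})"
  using assms by (simp add: sum.remove[of K i] sum.remove[of "K - {i}" j])

lemma sum_fold:
  fixes f :: "nat \<Rightarrow> nat"
  assumes "finite K" "i \<in> K" "i \<noteq> j"
  shows "sum f (K - {j}) = f i + sum f (K - {i} - {j})"
proof -
  have "K - {j} - {i} = K - {i} - {j}" by blast
  then show ?thesis
    using assms sum.remove[of "K - {j}" i f] by simp
qed

text \<open>A chain in the grid of \<open>i\<close> and \<open>j\<close> acts as a single coordinate
  of side \<open>l\<close>, kept at index \<open>i\<close>. The region above it is therefore the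
  image of a box with one coordinate fewer, with all ranks raised by \<open>d\<close>.\<close>

lemma avoiding_scd_fold:
  fixes b :: "nat \<Rightarrow> nat"
  assumes K: "finite K" "i \<in> K" "j \<in> K" "i \<noteq> j"
    and path: "grid_path (b i) (b j) Q p q d l"
    and scd: "avoiding_scd (K - {j}) (b(i := l)) R' (box (K - {j}) (b(i := l)))"
    and R: "\<And>z z'. z \<in> box (K - {j}) (b(i := l)) \<Longrightarrow> z' \<in> box (K - {j}) (b(i := l)) \<Longrightarrow>
      R (z(i := p (z i), j := q (z i))) (z'(i := p (z' i), j := q (z' i))) \<Longrightarrow> R' z z'"
  shows "avoiding_scd K b R {z \<in> box K b. Q (z i) (z j)}"
proof -
  define f where "f z = z(i := p (z i), j := q (z i))" for z :: "nat \<Rightarrow> nat"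
  let ?B = "box (K - {j}) (b(i := l))"
  have le: "z i \<le> l" if "z \<in> ?B" for z
    using that K by (auto simp: box_def split: if_splits)
  have pq: "Q (p t) (q t)" "p t + q t = d + t" "p t \<le> b i" "q t \<le> b j" if "t \<le> l" for t
    using path that unfolding grid_path_def by blast+
  have region: "f ` ?B = {z \<in> box K b. Q (z i) (z j)}"
  proof (intro subset_antisym subsetI)
    fix z assume "z \<in> f ` ?B"
    then obtain w where w: "w \<in> ?B" "z = f w" by blast
    show "z \<in> {z \<in> box K b. Q (z i) (z j)}"
      using w pq[OF le[OF w(1)]] K by (auto simp: f_def box_def split: if_splits)
  next
    fix z assume z: "z \<in> {z \<in> box K b. Q (z i) (z j)}"
    then have "z i + z j \<le> d + l" "p (z i + z j - d) = z i" "q (z i + z j - d) = z j"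
      using path unfolding grid_path_def by blast+
    \<comment> \<open>The position on the path is the rank in the grid minus \<open>d\<close>; index
      \<open>j\<close>, no longer a coordinate of the box, is reset to 0.\<close>
    then have "z = f (z(i := z i + z j - d, j := 0))" "z(i := z i + z j - d, j := 0) \<in> ?B"
      using z K by (auto simp: f_def box_def)
    then show "z \<in> f ` ?B" by blast
  qed
  have "avoiding_scd K b R (f ` ?B)"
  proof (rule avoiding_scd_image[OF _ _ _ _ scd])
    show "inj_on f ?B"
    proof (rule inj_onI)
      fix x y assume xy: "x \<in> ?B" "y \<in> ?B" "f x = f y"
      have eq: "x k = y k" if "k \<noteq> i" "k \<noteq> j" for k
        using fun_cong[OF xy(3), of k] that by (simp add: f_def)
      have "p (x i) = p (y i)" "q (x i) = q (y i)"
        using fun_cong[OF xy(3), of i] fun_cong[OF xy(3), of j] K by (simp_all add: f_def)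
      then have "d + x i = d + y i"
        using pq(2)[OF le[OF xy(1)]] pq(2)[OF le[OF xy(2)]] by metis
      then have "x i = y i" by simp
      moreover have "x j = y j"
        using xy by (simp add: box_def)
      ultimately show "x = y"
        using eq by (intro ext) metis
    qed
    show "f x \<le> f y" if "x \<in> ?B" "y \<in> ?B" "x \<le> y" for x y
      using path le[OF that(2)] that(3) unfolding grid_path_def f_def le_fun_def by simp
    have off: "sum (z(i := c, j := e)) (K - {i} - {j}) = sum z (K - {i} - {j})" for z :: "nat \<Rightarrow> nat" and c e
      by (rule sum.cong) auto
    have off1: "sum (z(i := c)) (K - {i} - {j}) = sum z (K - {i} - {j})" for z :: "nat \<Rightarrow> nat" and c
      by (rule sum.cong) auto
    show "sum (f x) K = d + sum x (K - {j})" if "x \<in> ?B" for x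
      using pq(2)[OF le[OF that]] K
      by (simp add: sum_two[OF K] sum_fold[OF K(1,2,4)] f_def off)
    show "2 * d + sum (b(i := l)) (K - {j}) = sum b K"
      using path by (simp add: sum_two[OF K] sum_fold[OF K(1,2,4)] off1 grid_path_def)
  qed (use R f_def in auto)
  then show ?thesis by (simp add: region)
qed

text \<open>This region is what \<open>e\<close> hooks leave over. Both sides shrink by
  \<open>e\<close> while the ranks rise by \<open>e\<close>, so the centre stays in place.\<close>

lemma avoiding_scd_subgrid:
  fixes b :: "nat \<Rightarrow> nat"
  assumes K: "finite K" "i \<in> K" "j \<in> K" "i \<noteq> j"
    and e: "e \<le> b i" "e \<le> b j"
    and scd: "avoiding_scd K (b(i := b i - e, j := b j - e)) R'
      (box K (b(i := b i - e, j := b j - e)))"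
    and R: "\<And>z z'. z \<in> box K (b(i := b i - e, j := b j - e)) \<Longrightarrow>
      z' \<in> box K (b(i := b i - e, j := b j - e)) \<Longrightarrow>
      R (z(j := z j + e)) (z'(j := z' j + e)) \<Longrightarrow> R' z z'"
  shows "avoiding_scd K b R {z \<in> box K b. z i \<le> b i - e \<and> e \<le> z j}"
proof -
  let ?B = "box K (b(i := b i - e, j := b j - e))"
  let ?f = "\<lambda>z::nat \<Rightarrow> nat. z(j := z j + e)"
  have region: "?f ` ?B = {z \<in> box K b. z i \<le> b i - e \<and> e \<le> z j}"
  proof (intro subset_antisym subsetI)
    fix z assume z: "z \<in> {z \<in> box K b. z i \<le> b i - e \<and> e \<le> z j}"
    then have "z = ?f (z(j := z j - e))" "z(j := z j - e) \<in> ?B"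
      using K by (auto simp: box_def)
    then show "z \<in> ?f ` ?B" by blast
  next
    fix z assume "z \<in> ?f ` ?B"
    then obtain w where w: "w \<in> ?B" "z = ?f w" by blast
    have "w k \<le> b k" if "k \<in> K" "k \<noteq> i" "k \<noteq> j" for k
      using w that unfolding box_def by fastforce
    moreover have "w i \<le> b i - e" "w j \<le> b j - e" "\<And>k. k \<notin> K \<Longrightarrow> w k = 0"
      using w K by (auto simp: box_def)
    moreover from this have "w i \<le> b i" "w j + e \<le> b j"
      using e by auto
    ultimately show "z \<in> {z \<in> box K b. z i \<le> b i - e \<and> e \<le> z j}"
      using w(2) K by (auto simp: box_def)
  qed
  have off: "sum (z(j := e)) (K - {i} - {j}) = sum z (K - {i} - {j})" for z :: "nat \<Rightarrow> nat" and e
    by (rule sum.cong) auto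
  have off2: "sum (z(i := c, j := e)) (K - {i} - {j}) = sum z (K - {i} - {j})" for z :: "nat \<Rightarrow> nat" and c e
    by (rule sum.cong) auto
  have "avoiding_scd K b R (?f ` ?B)"
  proof (rule avoiding_scd_image[OF _ _ _ _ scd])
    show "inj_on ?f ?B"
      by (rule inj_onI) (metis add_right_cancel fun_upd_eqD fun_upd_triv fun_upd_upd)
    show "?f x \<le> ?f y" if "x \<le> y" for x y
      using that by (simp add: le_fun_def)
    show "sum (?f x) K = e + sum x K" for x
      using K(4) by (simp add: sum_two[OF K] off)
    show "2 * e + sum (b(i := b i - e, j := b j - e)) K = sum b K"
      using e K(4) by (simp add: sum_two[OF K] off2)
  qed (use R in auto)
  then show ?thesis by (simp add: region)
qed

section \<open>Avoiding clashes\<close>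

text \<open>The endpoints \<open>u\<close> and \<open>v\<close> are parameters because folding two coordinates into one moves them:
  they need not be \<open>0\<close> and the side length of the folded box.\<close>
definition clash :: "nat set \<Rightarrow> (nat \<Rightarrow> nat) \<Rightarrow> (nat \<Rightarrow> nat) \<Rightarrow> nat set set \<Rightarrow>
    (nat \<Rightarrow> nat) \<Rightarrow> (nat \<Rightarrow> nat) \<Rightarrow> bool" where
  "clash K u v \<I> x y \<longleftrightarrow> (\<exists>I\<in>\<I>. \<forall>i\<in>K. if i \<in> I then x i = u i \<and> y i = v i else x i = y i)"

text \<open>The hooks from \<open>(0, s)\<close> along \<open>(a - s, s)\<close> to \<open>(a - s, b)\<close> partition the grid into symmetric chains,
  but the hook \<open>s = 0\<close> contains whole sides. In \<open>grid_path_first\<close> and \<open>grid_path_second\<close> the hooks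
  \<open>s = 0, 1\<close> are recombined so that no chain contains both ends of a row or of a column. In
  \<open>grid_path_third0\<close> to \<open>grid_path_third2\<close> the hooks \<open>s = 0, 1, 2\<close> are recombined so that, moreover, no
  chain contains both ends of a row shortened by its first point, nor both \<open>(1, 0)\<close> and \<open>(a, b)\<close>.\<close>
lemma grid_path_first:
  assumes "a \<ge> 2" "b \<ge> 2"
  shows "grid_path a b
    (\<lambda>x y. x = 0 \<and> y = 0 \<or> y = 1 \<and> x \<le> a - 1 \<or> x = a - 1 \<and> 1 \<le> y \<and> y \<le> b \<or> x = a \<and> y = b)
    (\<lambda>t. if t = 0 then 0 else if t \<le> a then t - 1 else if t < a + b then a - 1 else a)
    (\<lambda>t. if t = 0 then 0 else if t \<le> a then 1 else if t < a + b then t - a + 1 else b)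
    0 (a + b)"
  unfolding grid_path_def using assms by (intro conjI allI impI) (auto split: if_splits)

lemma grid_path_second:
  assumes "a \<ge> 2" "b \<ge> 2"
  shows "grid_path a b (\<lambda>x y. y = 0 \<and> 1 \<le> x \<and> x \<le> a \<or> x = a \<and> y \<le> b - 1)
    (\<lambda>t. if t < a then t + 1 else a) (\<lambda>t. if t < a then 0 else t + 1 - a) 1 (a + b - 2)"
  unfolding grid_path_def using assms by (intro conjI allI impI) (auto split: if_splits)

lemma grid_path_hook:
  "grid_path a b (\<lambda>x y. y = 0 \<and> x \<le> a \<or> x = a \<and> y \<le> b)
    (\<lambda>t. min t a) (\<lambda>t. t - a) 0 (a + b)"
  unfolding grid_path_def by (intro conjI allI impI) (auto simp: min_def)

lemma grid_path_third0:
  assumes "a \<ge> 3" "b \<ge> 3"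
  shows "grid_path a b
    (\<lambda>x y. x = 0 \<and> y \<le> 1 \<or> y = 2 \<and> x \<le> a - 2 \<or> x = a - 2 \<and> 2 \<le> y \<and> y \<le> b \<or> a - 2 \<le> x \<and> x \<le> a \<and> y = b)
    (\<lambda>t. if t \<le> 2 then 0 else if t \<le> a then t - 2 else if t < a + b - 2 then a - 2 else t - b)
    (\<lambda>t. if t \<le> 2 then t else if t \<le> a then 2 else if t < a + b - 2 then t + 2 - a else b)
    0 (a + b)"
  unfolding grid_path_def using assms by (intro conjI allI impI) (auto split: if_splits)

lemma grid_path_third1:
  assumes "a \<ge> 3" "b \<ge> 3"
  shows "grid_path a b
    (\<lambda>x y. x = 1 \<and> y = 0 \<or> y = 1 \<and> 1 \<le> x \<and> x \<le> a - 1 \<or> x = a - 1 \<and> 1 \<le> y \<and> y \<le> b - 1 \<or> x = a \<and> y = b - 1)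
    (\<lambda>t. if t = 0 then 1 else if t < a then t else if t < a + b - 2 then a - 1 else a)
    (\<lambda>t. if t = 0 then 0 else if t < a then 1 else if t < a + b - 2 then t + 2 - a else b - 1)
    1 (a + b - 2)"
  unfolding grid_path_def using assms by (intro conjI allI impI) (auto split: if_splits)

lemma grid_path_third2:
  assumes "a \<ge> 3" "b \<ge> 3"
  shows "grid_path a b (\<lambda>x y. y = 0 \<and> 2 \<le> x \<and> x \<le> a \<or> x = a \<and> y \<le> b - 2)
    (\<lambda>t. if t + 2 < a then t + 2 else a) (\<lambda>t. if t + 2 < a then 0 else t + 2 - a) 2 (a + b - 4)"
  unfolding grid_path_def using assms by (intro conjI allI impI) (auto split: if_splits)

text \<open>Any symmetric chain decomposition of a two-row grid keeps one row whole. Here it is the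
  row \<open>y = 1\<close>, in \<open>grid_path_left\<close> the row \<open>y = 0\<close>.\<close>

lemma grid_path_right:
  assumes "a \<ge> 1" "b = 1"
  shows "grid_path a b (\<lambda>x y. x = 0 \<and> y = 0 \<or> x \<le> a \<and> y = 1)
    (\<lambda>t. t - 1) (\<lambda>t. min t 1) 0 (a + 1)"
    "grid_path a b (\<lambda>x y. 1 \<le> x \<and> x \<le> a \<and> y = 0) (\<lambda>t. t + 1) (\<lambda>t. 0) 1 (a - 1)"
  unfolding grid_path_def using assms by (intro conjI allI impI; auto simp: min_def)+

lemma grid_path_left:
  assumes "a \<ge> 1" "b = 1"
  shows "grid_path a b (\<lambda>x y. x = a \<and> y = 1 \<or> x \<le> a \<and> y = 0)
    (\<lambda>t. min t a) (\<lambda>t. t - a) 0 (a + 1)"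
    "grid_path a b (\<lambda>x y. x < a \<and> y = 1) (\<lambda>t. t) (\<lambda>t. 1) 1 (a - 1)"
  unfolding grid_path_def using assms by (intro conjI allI impI; auto simp: min_def)+

text \<open>A clash on a set missing both coordinates forces equal grid points, hence equal
  positions, and survives unchanged. Any other clash becomes one on
  \<open>insert i (I - {j})\<close> between the positions \<open>u' i\<close> and
  \<open>v' i\<close>; where the path excludes it, \<open>meet\<close> holds by
  contradiction.\<close>

lemma clash_fold:
  assumes K: "i \<in> K" "j \<in> K" "i \<noteq> j"
    and path: "grid_path (b i) (b j) Q p q d l"
    and z: "z \<in> box (K - {j}) (b(i := l))" "z' \<in> box (K - {j}) (b(i := l))"
    and clash: "clash K u v \<I> (z(i := p (z i), j := q (z i))) (z'(i := p (z' i), j := q (z' i)))"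
    and uv: "\<And>k. k \<in> K - {i, j} \<Longrightarrow> u' k = u k \<and> v' k = v k"
    and avoid: "\<And>I. I \<in> \<I> \<Longrightarrow> i \<notin> I \<Longrightarrow> j \<notin> I \<Longrightarrow> I \<in> \<I>'"
    and meet: "\<And>I s t. I \<in> \<I> \<Longrightarrow> i \<in> I \<or> j \<in> I \<Longrightarrow> s \<le> l \<Longrightarrow> t \<le> l \<Longrightarrow>
      (if i \<in> I then p s = u i \<and> p t = v i else p s = p t) \<Longrightarrow>
      (if j \<in> I then q s = u j \<and> q t = v j else q s = q t) \<Longrightarrow>
      s = u' i \<and> t = v' i \<and> insert i (I - {j}) \<in> \<I>'"
  shows "clash (K - {j}) u' v' \<I>' z z'"
proof -
  obtain I where I: "I \<in> \<I>" and
    eq: "\<And>k. k \<in> K \<Longrightarrow> if k \<in> I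
      then (z(i := p (z i), j := q (z i))) k = u k \<and> (z'(i := p (z' i), j := q (z' i))) k = v k
      else (z(i := p (z i), j := q (z i))) k = (z'(i := p (z' i), j := q (z' i))) k"
    using clash unfolding clash_def by blast
  have off: "if k \<in> I then z k = u k \<and> z' k = v k else z k = z' k" if "k \<in> K - {i, j}" for k
    using eq[of k] that by (auto split: if_splits)
  have on_i: "if i \<in> I then p (z i) = u i \<and> p (z' i) = v i else p (z i) = p (z' i)"
    using eq[of i] K by (auto split: if_splits)
  have on_j: "if j \<in> I then q (z i) = u j \<and> q (z' i) = v j else q (z i) = q (z' i)"
    using eq[of j] K by (auto split: if_splits)
  have le: "z i \<le> l" "z' i \<le> l"
    using z K by (auto simp: box_def split: if_splits)
  show ?thesis
  proof (cases "i \<in> I \<or> j \<in> I")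
    case True
    note m = meet[OF I True le on_i on_j]
    show ?thesis
      unfolding clash_def
    proof (intro bexI[of _ "insert i (I - {j})"] ballI)
      fix k assume "k \<in> K - {j}"
      then show "if k \<in> insert i (I - {j}) then z k = u' k \<and> z' k = v' k else z k = z' k"
        using m off[of k] uv[of k] by (cases "k = i") auto
    qed (use m in auto)
  next
    case False
    then have "p (z i) + q (z i) = p (z' i) + q (z' i)"
      using on_i on_j by auto
    then have "d + z i = d + z' i"
      using path le unfolding grid_path_def by metis
    then have "z i = z' i" by simp
    then show ?thesis
      unfolding clash_def
    proof (intro bexI[of _ I] ballI)
      fix k assume "k \<in> K - {j}"
      then show "if k \<in> I then z k = u' k \<and> z' k = v' k else z k = z' k"
        using \<open>z i = z' i\<close> False off[of k] uv[of k] by (cases "k = i") auto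
    qed (use avoid I False in auto)
  qed
qed

text \<open>By \<open>miss\<close>, the subgrid omits an endpoint of every clash that involves
  \<open>i\<close> or \<open>j\<close>, so only clashes elsewhere survive.\<close>

lemma clash_subgrid:
  assumes K: "i \<in> K" "j \<in> K" "i \<noteq> j"
    and z: "z \<in> box K (b(i := b i - e, j := b j - e))" "z' \<in> box K (b(i := b i - e, j := b j - e))"
    and clash: "clash K u v \<I> (z(j := z j + e)) (z'(j := z' j + e))"
    and avoid: "\<And>I. I \<in> \<I> \<Longrightarrow> i \<notin> I \<Longrightarrow> j \<notin> I \<Longrightarrow> I \<in> \<I>'"
    and miss: "\<And>I. I \<in> \<I> \<Longrightarrow> i \<in> I \<or> j \<in> I \<Longrightarrow> i \<in> I \<and> b i - e < v i \<or> j \<in> I \<and> u j < e"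
  shows "clash K u v \<I>' z z'"
proof -
  obtain I where I: "I \<in> \<I>" and
    eq: "\<And>k. k \<in> K \<Longrightarrow> if k \<in> I
      then (z(j := z j + e)) k = u k \<and> (z'(j := z' j + e)) k = v k
      else (z(j := z j + e)) k = (z'(j := z' j + e)) k"
    using clash unfolding clash_def by blast
  have zi: "z' i \<le> b i - e"
    using z K by (auto simp: box_def split: if_splits)
  have "i \<notin> I \<and> j \<notin> I"
  proof (rule ccontr)
    assume "\<not> (i \<notin> I \<and> j \<notin> I)"
    then show False
      using miss[OF I] eq[OF K(1)] eq[OF K(2)] K zi by auto
  qed
  moreover have "if k \<in> I then z k = u k \<and> z' k = v k else z k = z' k" if "k \<in> K" for k
    using eq[OF that] calculation by (cases "k = j") (auto split: if_splits)
  ultimately have "I \<in> \<I>'" "\<forall>k\<in>K. if k \<in> I then z k = u k \<and> z' k = v k else z k = z' k"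
    using avoid I by auto
  then show ?thesis
    unfolding clash_def by blast
qed

section \<open>Gluing decompositions of grid regions\<close>

lemma avoiding_scd_Collect_disj:
  assumes "avoiding_scd K b R {z \<in> X. P z}" "avoiding_scd K b R {z \<in> X. Q z}"
    and "\<And>z. P z \<Longrightarrow> Q z \<Longrightarrow> False"
  shows "avoiding_scd K b R {z \<in> X. P z \<or> Q z}"
proof -
  have "{z \<in> X. P z \<or> Q z} = {z \<in> X. P z} \<union> {z \<in> X. Q z}" by blast
  then show ?thesis
    using avoiding_scd_Un[OF assms(1,2)] assms(3) by auto
qed

lemma avoiding_scd_all:
  assumes "i \<in> K" "j \<in> K" "avoiding_scd K b R {z \<in> box K b. P (z i) (z j)}"
    and "\<And>x y. x \<le> b i \<Longrightarrow> y \<le> b j \<Longrightarrow> P x y"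
  shows "avoiding_scd K b R (box K b)"
proof -
  have "{z \<in> box K b. P (z i) (z j)} = box K b"
    using assms by (auto simp: box_def)
  then show ?thesis using assms(3) by simp
qed

text \<open>The classical decomposition of a product of chains: the outer hook of a two-dimensional
  grid folds into one coordinate, and the subgrid inside it gives a smaller box. Folding lowers
  \<open>card K\<close> and keeps the sum of the sides; the subgrid keeps \<open>card K\<close> and
  lowers the sum by 2.\<close>

lemma avoiding_scd_box:
  assumes "finite K"
  shows "avoiding_scd K b (\<lambda>_ _. False) (box K b)"
  using assms
proof (induction "card K + sum b K" arbitrary: K b rule: less_induct)
  case less
  show ?case
  proof (cases "\<exists>i\<in>K. \<exists>j\<in>K. i \<noteq> j")
    case True
    then obtain i j where ij: "i \<in> K" "j \<in> K" "i \<noteq> j" by blast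
    let ?H = "{z \<in> box K b. z j = 0 \<and> z i \<le> b i \<or> z i = b i \<and> z j \<le> b j}"
    have off1: "sum (b(i := l)) (K - {i} - {j}) = sum b (K - {i} - {j})" for l
      by (rule sum.cong) auto
    have off2: "sum (b(i := c, j := e)) (K - {i} - {j}) = sum b (K - {i} - {j})" for c e
      by (rule sum.cong) auto
    have "card (K - {j}) < card K"
      using less.prems ij by (intro psubset_card_mono) auto
    then have "card (K - {j}) + sum (b(i := b i + b j)) (K - {j}) < card K + sum b K"
      using ij less.prems
      by (simp add: sum_two[OF less.prems ij] sum_fold[OF less.prems ij(1,3)] off1)
    then have hook: "avoiding_scd K b (\<lambda>_ _. False) ?H"
      using less.hyps[of "K - {j}" "b(i := b i + b j)"] less.prems
      by (intro avoiding_scd_fold[OF less.prems ij grid_path_hook]) auto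
    show ?thesis
    proof (cases "b i \<ge> 1 \<and> b j \<ge> 1")
      case True
      let ?G = "{z \<in> box K b. z i \<le> b i - 1 \<and> 1 \<le> z j}"
      have "card K + sum (b(i := b i - 1, j := b j - 1)) K < card K + sum b K"
        using ij True by (simp add: sum_two[OF less.prems ij] off2)
      then have "avoiding_scd K b (\<lambda>_ _. False) ?G"
        using less.hyps[of K "b(i := b i - 1, j := b j - 1)"] less.prems True
        by (intro avoiding_scd_subgrid[OF less.prems ij]) auto
      then have "avoiding_scd K b (\<lambda>_ _. False) (?H \<union> ?G)"
        using hook True by (intro avoiding_scd_Un) auto
      moreover have "box K b = ?H \<union> ?G"
        using ij True by (fastforce simp: box_def)
      ultimately show ?thesis by simp
    next
      case False
      \<comment> \<open>A grid with a side of length 0 is its own hook.\<close>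
      then have "box K b = ?H"
        using ij by (fastforce simp: box_def)
      then show ?thesis using hook by simp
    qed
  next
    case False
    then consider "K = {}" | i where "K = {i}" by blast
    then show ?thesis
    proof cases
      case 1
      then have "box K b = {\<lambda>_. 0}" by (auto simp: box_def)
      moreover have "partition_on {\<lambda>_. 0::nat} {{\<lambda>_. 0}}"
        by (rule partition_on_space) simp
      ultimately show ?thesis
        using 1 unfolding avoiding_scd_def
        by (intro exI[of _ "{box K b}"]) (auto simp: box_chain_def)
    next
      case 2
      have "z = (\<lambda>_. 0)(i := z i)" if "z \<in> box K b" for z
        using that 2 by (auto simp: box_def)
      then have "bij_betw (\<lambda>z. z i) (box K b) {0..b i}"
        using 2 by (intro bij_betw_byWitness[where f' = "\<lambda>t. (\<lambda>_. 0)(i := t)"]) (auto simp: box_def)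
      moreover have "x \<le> y \<or> y \<le> x" if "x \<in> box K b" "y \<in> box K b" for x y
      proof -
        have "\<And>k. k \<noteq> i \<Longrightarrow> x k = y k"
          using that 2 by (simp add: box_def)
        then show ?thesis
          unfolding le_fun_def by (metis le_cases order_refl)
      qed
      ultimately have "box_chain K b (box K b)"
        using 2 unfolding box_chain_def by (auto intro!: exI[of _ 0])
      moreover have "(\<lambda>_. 0) \<in> box K b"
        by (simp add: box_def)
      then have "partition_on (box K b) {box K b}"
        by (intro partition_on_space) auto
      ultimately show ?thesis
        unfolding avoiding_scd_def by blast
    qed
  qed
qed

lemma avoiding_scd_no_clash: "finite K \<Longrightarrow> avoiding_scd K b (clash K u v {}) (box K b)"
  using avoiding_scd_box[of K b] by (simp add: avoiding_scd_def clash_def)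

text \<open>Three regions: the path through both extreme corners, the second path, and the subgrid.
  On the first, a clash involves both of \<open>i\<close> and \<open>j\<close> or neither; if both,
  it runs from bottom to top of the folded coordinate. The other two contain neither both ends of a
  row or column nor both extreme corners, so only clashes avoiding \<open>i\<close> and
  \<open>j\<close> remain there.\<close>

lemma avoiding_clash_split:
  assumes K: "finite K" "i \<in> K" "j \<in> K" "i \<noteq> j" and b: "b i \<ge> 2" "b j \<ge> 2"
    and i: "\<And>I. I \<in> \<I> \<Longrightarrow> i \<in> I \<Longrightarrow> u i = 0 \<and> v i = b i"
    and j: "\<And>I. I \<in> \<I> \<Longrightarrow> j \<in> I \<Longrightarrow> u j = 0 \<and> v j = b j"
    and avoid: "\<And>I. I \<in> \<I> \<Longrightarrow> i \<notin> I \<Longrightarrow> j \<notin> I \<Longrightarrow> I \<in> \<J>"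
    and meet: "\<And>I. I \<in> \<I> \<Longrightarrow> i \<in> I \<longleftrightarrow> j \<in> I \<Longrightarrow> I - {j} \<in> \<I>'"
    and scd0: "avoiding_scd (K - {j}) (b(i := b i + b j))
      (clash (K - {j}) u (v(i := b i + b j)) \<I>') (box (K - {j}) (b(i := b i + b j)))"
    and scd1: "avoiding_scd (K - {j}) (b(i := b i + b j - 2))
      (clash (K - {j}) u v \<J>) (box (K - {j}) (b(i := b i + b j - 2)))"
    and scd2: "avoiding_scd K (b(i := b i - 2, j := b j - 2))
      (clash K u v \<J>) (box K (b(i := b i - 2, j := b j - 2)))"
  shows "avoiding_scd K b (clash K u v \<I>) (box K b)"
proof -
  let ?Q0 = "\<lambda>x y. x = 0 \<and> y = 0 \<or> y = 1 \<and> x \<le> b i - 1 \<or>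
    x = b i - 1 \<and> 1 \<le> y \<and> y \<le> b j \<or> x = b i \<and> y = b j"
  let ?Q1 = "\<lambda>x y. y = 0 \<and> 1 \<le> x \<and> x \<le> b i \<or> x = b i \<and> y \<le> b j - 1"
  let ?D0 = "{z \<in> box K b. ?Q0 (z i) (z j)}"
  let ?D1 = "{z \<in> box K b. ?Q1 (z i) (z j)}"
  let ?D2 = "{z \<in> box K b. z i \<le> b i - 2 \<and> 2 \<le> z j}"
  have D0: "avoiding_scd K b (clash K u v \<I>) ?D0"
  proof (rule avoiding_scd_fold[OF K grid_path_first[OF b] scd0],
      rule clash_fold[OF K(2-4) grid_path_first[OF b]], assumption, assumption, assumption, goal_cases)
    case (2 z z' I)
    then show ?case using meet[of I] by simp
  next
    case (3 z z' I s t)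
    consider "i \<in> I" "j \<in> I" | "i \<in> I" "j \<notin> I" | "i \<notin> I" "j \<in> I"
      using 3(5) by blast
    then show ?case
    proof cases
      case 1
      have "insert i (I - {j}) \<in> \<I>'"
        using meet[OF 3(4)] 1 K(4) by (simp add: insert_absorb)
      moreover have "s = 0"
        using 3(8,9) 1 i[OF 3(4)] j[OF 3(4)] b by (simp split: if_splits)
      moreover have "t = b i + b j"
        using 3(7-9) 1 i[OF 3(4)] j[OF 3(4)] b by (simp split: if_splits)
      ultimately show ?thesis using i[OF 3(4)] 1 by simp
    next
      case 2
      then have False
        using 3(6-9) i[OF 3(4)] b by (simp split: if_splits)
      then show ?thesis ..
    next
      case j_only: 3
      then have False
        using 3(6-9) j[OF 3(4)] b by (simp split: if_splits)
      then show ?thesis ..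
    qed
  qed auto
  have D1: "avoiding_scd K b (clash K u v \<I>) ?D1"
  proof (rule avoiding_scd_fold[OF K grid_path_second[OF b] scd1],
      rule clash_fold[OF K(2-4) grid_path_second[OF b]], assumption, assumption, assumption, goal_cases)
    case (3 z z' I s t)
    then show ?case
      using i[OF 3(4)] j[OF 3(4)] b by (auto split: if_splits)
  qed (use avoid in auto)
  have D2: "avoiding_scd K b (clash K u v \<I>) ?D2"
  proof (rule avoiding_scd_subgrid[OF K b scd2],
      rule clash_subgrid[OF K(2-4)], assumption, assumption, assumption, goal_cases)
    case (2 z z' I)
    then show ?case
      using i[OF 2(4)] j[OF 2(4)] b by linarith
  qed (use avoid in auto)
  show ?thesis
  proof (rule avoiding_scd_all[OF K(2,3), where
        P = "\<lambda>x y. (?Q0 x y \<or> ?Q1 x y) \<or> x \<le> b i - 2 \<and> 2 \<le> y"],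
      intro avoiding_scd_Collect_disj[OF avoiding_scd_Collect_disj[OF D0 D1] D2], goal_cases)
    case (1 z)
    then show ?case using b by linarith
  next
    case (2 z)
    then show ?case using b by linarith
  next
    case (3 x y)
    consider "x + 2 \<le> b i" "2 \<le> y" | "x = b i - 1" | "x = b i" | "y = 0" | "y = 1"
      using 3(1) by linarith
    then show ?case
    proof cases
      case 2
      then show ?thesis using 3 b by (cases "y = 0") auto
    next
      case x: 3
      then show ?thesis using 3(2) by (cases "y = b j") auto
    next
      case 4
      then show ?thesis using 3 by (cases "x = 0") auto
    next
      case 5
      then show ?thesis using 3 b by (cases "x = b i") auto
    qed auto
  qed
qed

text \<open>For paths that never contain both ends of a clash involving \<open>i\<close> or
  \<open>j\<close>; the last three hypotheses check this according to which of the two lie in the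
  set.\<close>

lemma avoiding_clash_fold:
  assumes K: "finite K" "i \<in> K" "j \<in> K" "i \<noteq> j"
    and path: "grid_path (b i) (b j) Q p q d l"
    and avoid: "\<And>I. I \<in> \<I> \<Longrightarrow> i \<notin> I \<Longrightarrow> j \<notin> I \<Longrightarrow> I \<in> \<J>"
    and scd: "avoiding_scd (K - {j}) (b(i := l)) (clash (K - {j}) u v \<J>) (box (K - {j}) (b(i := l)))"
    and both: "\<And>I. I \<in> \<I> \<Longrightarrow> i \<in> I \<Longrightarrow> j \<in> I \<Longrightarrow> \<not> (Q (u i) (u j) \<and> Q (v i) (v j))"
    and left: "\<And>I y. I \<in> \<I> \<Longrightarrow> i \<in> I \<Longrightarrow> j \<notin> I \<Longrightarrow> \<not> (Q (u i) y \<and> Q (v i) y)"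
    and right: "\<And>I x. I \<in> \<I> \<Longrightarrow> i \<notin> I \<Longrightarrow> j \<in> I \<Longrightarrow> \<not> (Q x (u j) \<and> Q x (v j))"
  shows "avoiding_scd K b (clash K u v \<I>) {z \<in> box K b. Q (z i) (z j)}"
proof (rule avoiding_scd_fold[OF K path scd],
    rule clash_fold[OF K(2-4) path], assumption, assumption, assumption, goal_cases)
  case (3 z z' I s t)
  have Q: "Q (p s) (q s)" "Q (p t) (q t)"
    using path 3(6,7) unfolding grid_path_def by blast+
  consider "i \<in> I" "j \<in> I" | "i \<in> I" "j \<notin> I" | "i \<notin> I" "j \<in> I"
    using 3(5) by blast
  then have False
  proof cases
    case 1
    then show False using Q 3(8,9) both[OF 3(4)] by simp
  next
    case 2
    then show False using Q 3(8,9) left[OF 3(4), of "q t"] by simp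
  next
    case only_j: 3
    then show False using Q \<open>if i \<in> I then _ else _\<close> \<open>if j \<in> I then _ else _\<close>
      right[OF \<open>I \<in> \<I>\<close>, of "p t"] by simp
  qed
  then show ?case ..
qed (use avoid in auto)

text \<open>Each split merges one \<open>m \<in> M\<close> with the free coordinate \<open>c\<close>. In all three parts \<open>m\<close> becomes the
  new free coordinate, as its side is still at least \<open>b m - 2 \<ge> 2\<close>.\<close>
lemma avoiding_clash_free_coordinate:
  assumes "finite K" "M \<subseteq> K" "c \<in> K - M" "b c \<ge> 2"
    and "\<And>i. i \<in> M \<Longrightarrow> b i \<ge> 4 \<and> u i = 0 \<and> v i = b i"
  shows "avoiding_scd K b (clash K u v (Pow M - {{}})) (box K b)"
  using assms
proof (induction "card M" arbitrary: K b M c v)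
  case 0
  then have "M = {}" using finite_subset[of M K] by auto
  then show ?case using avoiding_scd_no_clash 0 by simp
next
  case (Suc n)
  then obtain m where m: "m \<in> M" by fastforce
  have n: "n = card (M - {m})"
    using Suc.hyps(2) m by simp
  have mc: "m \<in> K" "c \<in> K" "m \<noteq> c" "c \<notin> M"
    using Suc.prems m by auto
  have bm: "b m \<ge> 4" "u m = 0" "v m = b m"
    using Suc.prems(5)[OF m] by auto
  show ?case
  proof (rule avoiding_clash_split[of K m c b _ u v "Pow (M - {m}) - {{}}" "Pow (M - {m}) - {{}}"])
    show "avoiding_scd (K - {c}) (b(m := b m + b c))
        (clash (K - {c}) u (v(m := b m + b c)) (Pow (M - {m}) - {{}}))
        (box (K - {c}) (b(m := b m + b c)))"
      by (rule Suc.hyps(1)[OF n, where c = m]) (use Suc.prems mc bm in auto)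
    show "avoiding_scd (K - {c}) (b(m := b m + b c - 2))
        (clash (K - {c}) u v (Pow (M - {m}) - {{}}))
        (box (K - {c}) (b(m := b m + b c - 2)))"
      by (rule Suc.hyps(1)[OF n, where c = m]) (use Suc.prems mc bm in auto)
    show "avoiding_scd K (b(m := b m - 2, c := b c - 2))
        (clash K u v (Pow (M - {m}) - {{}}))
        (box K (b(m := b m - 2, c := b c - 2)))"
      by (rule Suc.hyps(1)[OF n, where c = m]) (use Suc.prems mc bm in auto)
  qed (use Suc.prems mc bm in auto)
qed

text \<open>Merge two full coordinates \<open>m\<close> and \<open>c\<close>. On the first path a
  proper subset containing both stays proper after dropping \<open>c\<close>; elsewhere only clashes
  missing both remain, and \<open>m\<close> serves as the free coordinate. \<open>M\<close> itself
  is exempt because, when all sides outside \<open>M\<close> are 0, one chain must join bottom and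
  top.\<close>

lemma avoiding_proper_clash:
  assumes "finite K" "M \<subseteq> K" "M \<noteq> {}"
    and "\<And>i. i \<in> M \<Longrightarrow> b i \<ge> 4 \<and> u i = 0 \<and> v i = b i"
  shows "avoiding_scd K b (clash K u v (Pow M - {{}, M})) (box K b)"
  using assms
\<comment> \<open>The upper end \<open>v\<close> varies in the induction because merging lengthens
  the side of \<open>m\<close>.\<close>
proof (induction "card M" arbitrary: K b M v)
  case 0
  then show ?case using finite_subset[of M K] by auto
next
  case (Suc n)
  then obtain m where m: "m \<in> M" by blast
  show ?case
  proof (cases "M = {m}")
    case True
    then have "Pow M - {{}, M} = {}" by auto
    then show ?thesis using avoiding_scd_no_clash[OF Suc.prems(1)] by metis
  next
    case False
    then obtain c where c: "c \<in> M" "m \<noteq> c" using m by blast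
    have n: "n = card (M - {c})"
      using Suc.hyps(2) c by simp
    have mc: "m \<in> K" "c \<in> K" "m \<noteq> c"
      using Suc.prems m c by auto
    have bm: "b m \<ge> 4" "u m = 0" "v m = b m" "b c \<ge> 4" "u c = 0" "v c = b c"
      using Suc.prems(4) m c by auto
    show ?thesis
    proof (rule avoiding_clash_split[of K m c b _ u v "Pow (M - {m, c}) - {{}}" "Pow (M - {c}) - {{}, M - {c}}"])
      show "avoiding_scd (K - {c}) (b(m := b m + b c))
          (clash (K - {c}) u (v(m := b m + b c)) (Pow (M - {c}) - {{}, M - {c}}))
          (box (K - {c}) (b(m := b m + b c)))"
        by (rule Suc.hyps(1)[OF n]) (use Suc.prems m mc bm in auto)
      show "avoiding_scd (K - {c}) (b(m := b m + b c - 2))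
          (clash (K - {c}) u v (Pow (M - {m, c}) - {{}}))
          (box (K - {c}) (b(m := b m + b c - 2)))"
        by (rule avoiding_clash_free_coordinate[where c = m]) (use Suc.prems mc bm in auto)
      show "avoiding_scd K (b(m := b m - 2, c := b c - 2))
          (clash K u v (Pow (M - {m, c}) - {{}}))
          (box K (b(m := b m - 2, c := b c - 2)))"
        by (rule avoiding_clash_free_coordinate[where c = m]) (use Suc.prems mc bm in auto)
      show "I - {c} \<in> Pow (M - {c}) - {{}, M - {c}}"
        if "I \<in> Pow M - {{}, M}" "(m \<in> I) = (c \<in> I)" for I
        using that m c by (cases "c \<in> I") blast+
    qed (use Suc.prems mc bm in auto)
  qed
qed

text \<open>Folding a full coordinate \<open>m\<close> and a coordinate of length 1 gives a chain in which the clash of \<open>m\<close>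
  starts at position 1 instead of 0.\<close>
lemma avoiding_clash_raised_split:
  assumes K: "finite K" "i \<in> K" "j \<in> K" "i \<noteq> j" and b: "b i \<ge> 5" "b j \<ge> 4"
    and uv: "u i = 1" "v i = b i" "u j = 0" "v j = b j"
    and avoid: "\<And>I. I \<in> \<I> \<Longrightarrow> i \<notin> I \<Longrightarrow> j \<notin> I \<Longrightarrow> I \<in> \<J>"
    and scd: "\<And>l. l \<ge> 2 \<Longrightarrow> avoiding_scd (K - {j}) (b(i := l))
      (clash (K - {j}) u v \<J>) (box (K - {j}) (b(i := l)))"
    and scd3: "avoiding_scd K (b(i := b i - 3, j := b j - 3))
      (clash K u v \<J>) (box K (b(i := b i - 3, j := b j - 3)))"
  shows "avoiding_scd K b (clash K u v \<I>) (box K b)"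
proof -
  let ?Q0 = "\<lambda>x y. x = 0 \<and> y \<le> 1 \<or> y = 2 \<and> x \<le> b i - 2 \<or> x = b i - 2 \<and> 2 \<le> y \<and> y \<le> b j \<or>
    b i - 2 \<le> x \<and> x \<le> b i \<and> y = b j"
  let ?Q1 = "\<lambda>x y. x = 1 \<and> y = 0 \<or> y = 1 \<and> 1 \<le> x \<and> x \<le> b i - 1 \<or>
    x = b i - 1 \<and> 1 \<le> y \<and> y \<le> b j - 1 \<or> x = b i \<and> y = b j - 1"
  let ?Q2 = "\<lambda>x y. y = 0 \<and> 2 \<le> x \<and> x \<le> b i \<or> x = b i \<and> y \<le> b j - 2"
  have b3: "b i \<ge> 3" "b j \<ge> 3" using b by auto
  have "b i + b j \<ge> 2" "b i + b j - 2 \<ge> 2" "b i + b j - 4 \<ge> 2" using b by auto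
  note scds = scd[OF this(1)] scd[OF this(2)] scd[OF this(3)]
  have D0: "avoiding_scd K b (clash K u v \<I>) {z \<in> box K b. ?Q0 (z i) (z j)}"
  proof (rule avoiding_clash_fold[OF K grid_path_third0[OF b3] avoid scds(1)], goal_cases)
    case (4 I)
    then show ?case using uv b by simp
  next
    case (5 I y)
    then show ?case using uv b by auto
  next
    case (6 I x)
    then show ?case using uv b by auto
  qed
  have D1: "avoiding_scd K b (clash K u v \<I>) {z \<in> box K b. ?Q1 (z i) (z j)}"
  proof (rule avoiding_clash_fold[OF K grid_path_third1[OF b3] avoid scds(2)], goal_cases)
    case (4 I)
    then show ?case using uv b by simp
  next
    case (5 I y)
    then show ?case using uv b by auto
  next
    case (6 I x)
    then show ?case using uv b by auto
  qed
  have D2: "avoiding_scd K b (clash K u v \<I>) {z \<in> box K b. ?Q2 (z i) (z j)}"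
  proof (rule avoiding_clash_fold[OF K grid_path_third2[OF b3] avoid scds(3)], goal_cases)
    case (4 I)
    then show ?case using uv b by simp
  next
    case (5 I y)
    then show ?case using uv b by auto
  next
    case (6 I x)
    then show ?case using uv b by auto
  qed
  \<comment> \<open>Writing the sides as \<open>A + 5\<close> and \<open>B + 4\<close> removes
    truncated subtraction from the checks that the four regions are disjoint and cover the
    grid.\<close>
  obtain A B where AB: "b i = A + 5" "b j = B + 4"
    using b by (metis add.commute le_Suc_ex)
  have D3: "avoiding_scd K b (clash K u v \<I>) {z \<in> box K b. z i \<le> b i - 3 \<and> 3 \<le> z j}"
  proof (rule avoiding_scd_subgrid[OF K b3 scd3],
      rule clash_subgrid[OF K(2-4)], assumption, assumption, assumption, goal_cases)
    case (2 z z' I)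
    then show ?case using uv b by linarith
  qed (use avoid in auto)
  show ?thesis
  proof (rule avoiding_scd_all[OF K(2,3), where
        P = "\<lambda>x y. ((?Q0 x y \<or> ?Q1 x y) \<or> ?Q2 x y) \<or> x \<le> b i - 3 \<and> 3 \<le> y"],
      intro avoiding_scd_Collect_disj[OF
          avoiding_scd_Collect_disj[OF avoiding_scd_Collect_disj[OF D0 D1] D2] D3], goal_cases)
    case (1 z)
    then show ?case unfolding AB by auto
  next
    case (2 z)
    then show ?case unfolding AB by auto
  next
    case (3 z)
    then show ?case unfolding AB by auto
  next
    case (4 x y)
    have xy: "x \<le> A + 5" "y \<le> B + 4" using 4 AB by auto
    consider "x \<le> A + 2" "3 \<le> y" | "x = A + 3" | "x = A + 4" | "x = A + 5"
      | "y = 0" | "y = 1" | "y = 2"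
      using xy(1) by linarith
    then show ?case
    proof cases
      case 1
      then show ?thesis unfolding AB by simp
    next
      case 2
      then show ?thesis using xy unfolding AB by (cases "y \<ge> 2"; cases "y = 1"; simp)
    next
      case 3
      then show ?thesis using xy unfolding AB by (cases "y \<le> B + 3"; cases "y = 0"; simp)
    next
      case 4
      have "y \<le> B + 2 \<or> y = B + 3 \<or> y = B + 4" using xy by linarith
      then show ?thesis using 4 unfolding AB by (elim disjE; simp)
    next
      case 5
      then show ?thesis using xy unfolding AB by (cases "x = 0"; cases "x = 1"; simp)
    next
      case 6
      then show ?thesis using xy unfolding AB by (cases "x = 0"; cases "x = A + 5"; simp)
    next
      case 7
      then show ?thesis using xy unfolding AB by (cases "x \<le> A + 3"; cases "x = A + 4"; simp)
    qed
  qed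
qed

text \<open>The grid of \<open>m\<close> and \<open>d\<close> has two rows. The lower row without
  its first point admits no clash involving \<open>m\<close>. The other path admits one, starting at
  position 1, and the raised split with a second full coordinate \<open>c\<close> removes
  it.\<close>

lemma avoiding_clash_unit_coordinate:
  assumes K: "finite K" "M \<subseteq> K" "m \<in> M" "c \<in> M" "m \<noteq> c" "d \<in> K - M" and d: "b d = 1"
    and M: "\<And>i. i \<in> M \<Longrightarrow> b i \<ge> 4 \<and> u i = 0 \<and> v i = b i"
  shows "avoiding_scd K b (clash K u v (Pow M - {{}})) (box K b)"
proof -
  have md: "m \<in> K" "d \<in> K" "m \<noteq> d" "d \<notin> M" "c \<in> K" "c \<noteq> d"
    using K by auto
  have bm: "b m \<ge> 4" "u m = 0" "v m = b m" "b c \<ge> 4" "u c = 0" "v c = b c"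
    using M K by auto
  have bm2: "2 \<le> b m - 2" using bm by simp
  have bm3: "2 \<le> b m - 1" using bm by simp
  have m1: "b m \<ge> 1" using bm by simp
  note path = grid_path_right[OF m1 d]
  have X: "avoiding_scd (K - {d}) (b(m := b m + b d))
      (clash (K - {d}) (u(m := 1)) (v(m := b m + b d)) (Pow M - {{}})) (box (K - {d}) (b(m := b m + b d)))"
  proof (rule avoiding_clash_raised_split[where \<J> = "Pow (M - {m, c}) - {{}}" and i = m and j = c])
    show "avoiding_scd (K - {d} - {c}) (b(m := b m + b d, m := l))
      (clash (K - {d} - {c}) (u(m := 1)) (v(m := b m + b d)) (Pow (M - {m, c}) - {{}}))
      (box (K - {d} - {c}) (b(m := b m + b d, m := l)))" if "l \<ge> 2" for l
      by (rule avoiding_clash_free_coordinate[where c = m]) (use K md bm M that in auto)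
    show "avoiding_scd (K - {d})
      (b(m := b m + b d, m := (b(m := b m + b d)) m - 3, c := (b(m := b m + b d)) c - 3))
      (clash (K - {d}) (u(m := 1)) (v(m := b m + b d)) (Pow (M - {m, c}) - {{}}))
      (box (K - {d}) (b(m := b m + b d, m := (b(m := b m + b d)) m - 3, c := (b(m := b m + b d)) c - 3)))"
      by (rule avoiding_clash_free_coordinate[where c = m]) (use K d md bm bm2 M in auto)
  qed (use K d md bm in auto)
  have Y: "avoiding_scd (K - {d}) (b(m := b m - 1))
      (clash (K - {d}) u v (Pow (M - {m}) - {{}})) (box (K - {d}) (b(m := b m - 1)))"
    by (rule avoiding_clash_free_coordinate[where c = m]) (use K md bm bm3 M in auto)
  have D0: "avoiding_scd K b (clash K u v (Pow M - {{}}))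
      {z \<in> box K b. z m = 0 \<and> z d = 0 \<or> z m \<le> b m \<and> z d = 1}"
  proof (rule avoiding_scd_fold[OF K(1) md(1-3) path(1)], use X d in simp,
      rule clash_fold[OF md(1-3) path(1)], assumption, assumption, assumption, goal_cases)
    case (3 z z' I s t)
    \<comment> \<open>A clash fixes \<open>d\<close>, hence stays in one row; on this path only the
      row \<open>z d = 1\<close> has both ends of \<open>m\<close>, at positions 1 and
      \<open>b m + 1\<close>.\<close>
    then have "d \<notin> I" "m \<in> I" using md by auto
    then have "s = 1" "t = b m + 1"
      using 3(6-9) bm d by (auto split: if_splits)
    then show ?case using 3(4) \<open>d \<notin> I\<close> \<open>m \<in> I\<close> d by (simp add: insert_absorb)
  qed auto
  have D1: "avoiding_scd K b (clash K u v (Pow M - {{}}))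
      {z \<in> box K b. 1 \<le> z m \<and> z m \<le> b m \<and> z d = 0}"
  proof (rule avoiding_clash_fold[OF K(1) md(1-3) path(2) _ Y], goal_cases)
    case (3 I y)
    then show ?case using bm by simp
  qed (use md in auto)
  show ?thesis
  proof (rule avoiding_scd_all[OF md(1,2) avoiding_scd_Collect_disj[OF D0 D1]], goal_cases)
    case (1 z)
    then show ?case using d by linarith
  next
    case (2 x y)
    then show ?case using d by linarith
  qed
qed

text \<open>One row of the grid of \<open>m\<close> and \<open>d\<close> has to stay whole. Choosing
  the row \<open>z d = e\<close> confines the clashes of \<open>m\<close> to it.\<close>

lemma avoiding_clash_oriented:
  assumes K: "finite K" "m \<in> K" "d \<in> K" "m \<noteq> d" and b: "b m \<ge> 1" "b d = 1"
    and uv: "u m = 0" "v m = b m" and e: "e \<le> (1::nat)"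
  shows "avoiding_scd K b (\<lambda>x y. clash K u v {{m}} x y \<and> x d \<noteq> e) (box K b)"
proof -
  let ?R = "\<lambda>x y. clash K u v {{m}} x y \<and> x d \<noteq> e"
  have free: "avoiding_scd (K - {d}) b' (\<lambda>_ _. False) (box (K - {d}) b')" for b'
    using avoiding_scd_box[of "K - {d}"] K by simp
  have R: "x m = 0 \<and> y m = b m \<and> x d = y d \<and> x d \<noteq> e" if "?R x y" for x y
    using that K uv by (auto simp: clash_def)
  have le: "z m \<le> l" if "z \<in> box (K - {d}) (b(m := l))" for z l
    using that K by (auto simp: box_def split: if_splits)
  note right = grid_path_right[OF b] and left = grid_path_left[OF b]
  consider "e = 1" | "e = 0" using e by linarith
  then show ?thesis
  proof cases
    case 1
    have "avoiding_scd K b ?R {z \<in> box K b. z m = 0 \<and> z d = 0 \<or> z m \<le> b m \<and> z d = 1}"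
      by (rule avoiding_scd_fold[OF K right(1) free], drule R) (use b K 1 in \<open>auto simp: min_def split: if_splits\<close>)
    moreover have "avoiding_scd K b ?R {z \<in> box K b. 1 \<le> z m \<and> z m \<le> b m \<and> z d = 0}"
      by (rule avoiding_scd_fold[OF K right(2) free], drule R) (use b K in auto)
    ultimately have "avoiding_scd K b ?R {z \<in> box K b.
        (z m = 0 \<and> z d = 0 \<or> z m \<le> b m \<and> z d = 1) \<or> 1 \<le> z m \<and> z m \<le> b m \<and> z d = 0}"
      by (rule avoiding_scd_Collect_disj) auto
    then show ?thesis
      by (rule avoiding_scd_all[OF K(2,3)]) (use b in auto)
  next
    case 2
    have "avoiding_scd K b ?R {z \<in> box K b. z m = b m \<and> z d = 1 \<or> z m \<le> b m \<and> z d = 0}"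
      by (rule avoiding_scd_fold[OF K left(1) free], drule R) (use b K 2 in \<open>auto simp: min_def split: if_splits\<close>)
    moreover have "avoiding_scd K b ?R {z \<in> box K b. z m < b m \<and> z d = 1}"
    proof (rule avoiding_scd_fold[OF K left(2) free], drule R)
      fix z z' assume "z' \<in> box (K - {d}) (b(m := b m - 1))"
      then show False if "(z(m := z m, d := 1)) m = 0 \<and> (z'(m := z' m, d := 1)) m = b m \<and>
        (z(m := z m, d := 1)) d = (z'(m := z' m, d := 1)) d \<and> (z(m := z m, d := 1)) d \<noteq> e"
        using le that b K by fastforce
    qed
    ultimately have "avoiding_scd K b ?R {z \<in> box K b.
        (z m = b m \<and> z d = 1 \<or> z m \<le> b m \<and> z d = 0) \<or> z m < b m \<and> z d = 1}"
      by (rule avoiding_scd_Collect_disj) auto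
    then show ?thesis
      by (rule avoiding_scd_all[OF K(2,3)]) (use b in auto)
  qed
qed

section \<open>Decomposition of a box with arbitrary full coordinates\<close>

lemma avoiding_scd_weaken:
  assumes "avoiding_scd K b R X" and "\<And>x y. R' x y \<Longrightarrow> R x y"
  shows "avoiding_scd K b R' X"
proof -
  obtain P where "partition_on X P"
    "\<forall>C\<in>P. box_chain K b C \<and> (\<forall>x\<in>C. \<forall>y\<in>C. \<not> R x y)"
    using assms(1) unfolding avoiding_scd_def by (elim exE conjE)
  moreover from this assms(2) have "\<forall>C\<in>P. box_chain K b C \<and> (\<forall>x\<in>C. \<forall>y\<in>C. \<not> R' x y)"
    by blast
  ultimately show ?thesis
    unfolding avoiding_scd_def by (intro exI[of _ P] conjI)
qed

text \<open>\<open>bad\<close> holds all clashes except the unavoidable ones. A side of at least 2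
  outside \<open>M\<close> is a free coordinate and removes every clash, and so does a side of 1
  when \<open>M\<close> has at least two elements. If all sides outside \<open>M\<close> are 0, only
  proper subsets of \<open>M\<close> are treated. If \<open>M\<close> is a singleton and some side
  outside it is 1, the clashes are confined to \<open>x d = e\<close>.\<close>

lemma box_scd:
  assumes K: "finite K" "M \<subseteq> K" and M: "\<And>i. i \<in> M \<Longrightarrow> b i \<ge> 4"
    and d: "card M = 1 \<Longrightarrow> \<forall>i\<in>K - M. b i \<le> 1 \<Longrightarrow> \<exists>i\<in>K - M. b i = 1 \<Longrightarrow> d \<in> K - M \<and> b d = 1"
    and e: "e \<le> 1"
  defines "bad \<equiv> \<lambda>x y. \<exists>I\<in>Pow M - {{}}. (\<forall>i\<in>K. if i \<in> I then x i = 0 \<and> y i = b i else x i = y i) \<and>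
    \<not> (I = M \<and> ((\<forall>i\<in>K - M. b i = 0) \<or> card M = 1 \<and> d \<in> K - M \<and> b d = 1 \<and> x d = e))"
  shows "avoiding_scd K b bad (box K b)"
proof -
  let ?u = "\<lambda>_. 0 :: nat"
  have M4: "\<And>i. i \<in> M \<Longrightarrow> 4 \<le> b i \<and> ?u i = 0 \<and> b i = b i"
    using M by simp
  have all: "clash K ?u b (Pow M - {{}}) x y" if "bad x y" for x y
    using that unfolding bad_def clash_def by blast
  consider "M = {}"
    | c where "c \<in> K - M" "b c \<ge> 2"
    | "M \<noteq> {}" "\<forall>i\<in>K - M. b i = 0"
    | i where "\<forall>i\<in>K - M. b i \<le> 1" "i \<in> K - M" "b i = 1" "M \<noteq> {}" "card M \<noteq> 1"
    | i where "\<forall>i\<in>K - M. b i \<le> 1" "i \<in> K - M" "b i = 1" "card M = 1"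
  proof (cases "\<exists>c\<in>K - M. b c \<ge> 2")
    case True
    then show ?thesis using that(2) by blast
  next
    case False
    then have "\<forall>i\<in>K - M. b i \<le> 1" by force
    moreover from this have "(\<forall>i\<in>K - M. b i = 0) \<or> (\<exists>i\<in>K - M. b i = 1)" by force
    ultimately show ?thesis using that by metis
  qed
  then show ?thesis
  proof cases
    case 1
    then have "\<not> bad x y" for x y by (simp add: bad_def)
    then show ?thesis
      using avoiding_scd_weaken[OF avoiding_scd_box[OF K(1)]] by blast
  next
    case 2
    have "avoiding_scd K b (clash K ?u b (Pow M - {{}})) (box K b)"
      by (rule avoiding_clash_free_coordinate) (use K 2 M4 in auto)
    then show ?thesis
      by (rule avoiding_scd_weaken) (rule all)
  next
    case 3
    have "clash K ?u b (Pow M - {{}, M}) x y" if "bad x y" for x y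
      using that 3(2) unfolding bad_def clash_def by blast
    moreover have "avoiding_scd K b (clash K ?u b (Pow M - {{}, M})) (box K b)"
      by (rule avoiding_proper_clash) (use K 3 M4 in auto)
    ultimately show ?thesis
      by (rule avoiding_scd_weaken[rotated])
  next
    case 4
    then obtain m where m: "m \<in> M" by blast
    have "M \<noteq> {m}" using 4 by auto
    then obtain c where c: "c \<in> M" "m \<noteq> c" using m by blast
    have "avoiding_scd K b (clash K ?u b (Pow M - {{}})) (box K b)"
      by (rule avoiding_clash_unit_coordinate[where m = m and c = c and d = i])
        (use K m c 4 M4 in auto)
    then show ?thesis
      by (rule avoiding_scd_weaken) (rule all)
  next
    case 5
    then obtain m where m: "M = {m}" by (auto simp: card_1_singleton_iff)
    have dd: "d \<in> K - M" "b d = 1" using d 5 by blast+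
    have "clash K ?u b {{m}} x y \<and> x d \<noteq> e" if bad: "bad x y" for x y
    proof -
      obtain I where I: "I \<in> Pow M - {{}}"
        "\<forall>i\<in>K. if i \<in> I then x i = 0 \<and> y i = b i else x i = y i"
        "\<not> (I = M \<and> ((\<forall>i\<in>K - M. b i = 0) \<or> card M = 1 \<and> d \<in> K - M \<and> b d = 1 \<and> x d = e))"
        using bad unfolding bad_def by blast
      have "I = {m}" using I(1) m by blast
      then show ?thesis
        using I dd 5(4) m unfolding clash_def by blast
    qed
    moreover have "avoiding_scd K b (\<lambda>x y. clash K ?u b {{m}} x y \<and> x d \<noteq> e) (box K b)"
      by (rule avoiding_clash_oriented) (use K m dd M[of m] e in auto)
    ultimately show ?thesis
      by (rule avoiding_scd_weaken[rotated])
  qed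
qed

section \<open>Coordinates on cuboids\<close>

text \<open>The size \<open>j\<close> of the smallest member of a symmetric chain, recovered from
  its cardinality \<open>n + 1 - 2 * j\<close>.\<close>

definition level :: "nat \<Rightarrow> nat set set \<Rightarrow> nat" where
  "level n C = (n + 1 - card C) div 2"

lemma symmetric_chain_level:
  assumes "symmetric_chain n C"
  shows "2 * level n C + (card C - 1) = n" "bij_betw card C {level n C..n - level n C}" "card C \<ge> 1"
proof -
  obtain j where j: "2 * j \<le> n" "bij_betw card C {j..n - j}"
    using assms by (auto simp: symmetric_chain_def)
  have "card C = n - j + 1 - j"
    using bij_betw_same_card[OF j(2)] by simp
  then have "card C = n + 1 - 2 * j" using j by simp
  then have "level n C = j" "card C \<ge> 1" "2 * j + (card C - 1) = n"
    using j by (auto simp: level_def)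
  then show "2 * level n C + (card C - 1) = n" "bij_betw card C {level n C..n - level n C}" "card C \<ge> 1"
    using j by simp_all
qed

lemma symmetric_chain_subset: "symmetric_chain n C \<Longrightarrow> X \<in> C \<Longrightarrow> X \<subseteq> {1..n}"
  by (auto simp: symmetric_chain_def boolean_lattice_def)

lemma symmetric_chain_le_iff:
  assumes "symmetric_chain n C" "X \<in> C" "Y \<in> C"
  shows "card X \<le> card Y \<longleftrightarrow> X \<subseteq> Y"
proof
  have fin: "finite X" "finite Y"
    using symmetric_chain_subset[OF assms(1)] assms(2,3) finite_subset by blast+
  assume le: "card X \<le> card Y"
  have "X \<subseteq> Y \<or> Y \<subseteq> X"
    using assms by (auto simp: symmetric_chain_def chain_subset_def)
  then show "X \<subseteq> Y"
    using le fin card_seteq by blast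
next
  have "finite Y"
    using symmetric_chain_subset[OF assms(1,3)] finite_subset by blast
  then show "card X \<le> card Y" if "X \<subseteq> Y"
    using that by (rule card_mono)
qed

lemma symmetric_chain_card_range:
  assumes "symmetric_chain n C" "X \<in> C"
  shows "level n C \<le> card X" "card X \<le> level n C + (card C - 1)"
proof -
  have "card X \<in> {level n C..n - level n C}"
    using symmetric_chain_level(2)[OF assms(1)] assms(2) by (auto simp: bij_betw_def)
  then show "level n C \<le> card X" "card X \<le> level n C + (card C - 1)"
    using symmetric_chain_level(1)[OF assms(1)] by auto
qed

lemma symmetric_chain_obtain:
  assumes "symmetric_chain n C" "t \<le> card C - 1"
  obtains X where "X \<in> C" "card X = level n C + t"
proof -
  have "level n C + t \<in> {level n C..n - level n C}"
    using symmetric_chain_level(1)[OF assms(1)] assms(2) by auto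
  then have "level n C + t \<in> card ` C"
    using symmetric_chain_level(2)[OF assms(1)] by (simp add: bij_betw_def)
  then show thesis using that by auto
qed

lemma symmetric_chain_empty_iff:
  assumes "symmetric_chain n C"
  shows "{} \<in> C \<longleftrightarrow> level n C = 0" "{1..n} \<in> C \<longleftrightarrow> level n C = 0"
proof -
  show "{} \<in> C \<longleftrightarrow> level n C = 0"
  proof
    assume "level n C = 0"
    then obtain X where X: "X \<in> C" "card X = 0"
      using symmetric_chain_obtain[OF assms, of 0] by auto
    moreover have "finite X"
      using symmetric_chain_subset[OF assms X(1)] finite_subset by blast
    ultimately show "{} \<in> C" by simp
  qed (use symmetric_chain_card_range(1)[OF assms] in fastforce)
  show "{1..n} \<in> C \<longleftrightarrow> level n C = 0"
  proof
    assume "level n C = 0"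
    then obtain X where X: "X \<in> C" "card X = n"
      using symmetric_chain_obtain[OF assms, of n] symmetric_chain_level(1)[OF assms] by auto
    moreover have "X = {1..n}"
      using symmetric_chain_subset[OF assms X(1)] X(2) by (intro card_subset_eq) auto
    ultimately show "{1..n} \<in> C" by simp
  next
    assume "{1..n} \<in> C"
    then show "level n C = 0"
      using symmetric_chain_card_range(2)[OF assms, of "{1..n}"] symmetric_chain_level(1)[OF assms] by simp
  qed
qed

section \<open>Splitting subsets of the product cube into blocks\<close>

context
  fixes r :: nat and n :: "nat \<Rightarrow> nat"
begin

definition offset :: "nat \<Rightarrow> nat" where
  "offset i = (\<Sum>l\<in>{1..<i}. n l)"

text \<open>Undoes \<open>join_blocks\<close> in component \<open>i\<close>.\<close>

definition block :: "nat \<Rightarrow> nat set \<Rightarrow> nat set" where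
  "block i X = {x \<in> {1..n i}. offset i + x \<in> X}"

abbreviation (input) width :: nat where
  "width \<equiv> (\<Sum>i\<in>{1..r}. n i)"

lemma offset_mono:
  assumes "1 \<le> i" "i < i'"
  shows "offset i + n i \<le> offset i'"
proof -
  have "offset i + n i = (\<Sum>l\<in>{1..<Suc i}. n l)"
    using assms by (simp add: offset_def)
  also have "\<dots> \<le> offset i'"
    unfolding offset_def using assms by (intro sum_mono2) auto
  finally show ?thesis .
qed

lemma offset_unique:
  assumes "i \<in> {1..r}" "i' \<in> {1..r}" "x \<in> {1..n i}" "x' \<in> {1..n i'}" "offset i + x = offset i' + x'"
  shows "i = i'"
proof (rule ccontr)
  assume "i \<noteq> i'"
  then consider "i < i'" | "i' < i" by linarith
  then show False
    using offset_mono[of i i'] offset_mono[of i' i] assms by cases auto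
qed

lemma offset_le_total:
  assumes "i \<in> {1..r}" "x \<in> {1..n i}"
  shows "offset i + x \<in> {1..width}"
proof -
  have "offset i + n i = (\<Sum>l\<in>{1..<Suc i}. n l)"
    using assms by (simp add: offset_def)
  also have "\<dots> \<le> width"
    using assms by (intro sum_mono2) auto
  finally show ?thesis using assms by auto
qed

lemma offset_cover:
  assumes "y \<in> {1..width}"
  obtains i x where "i \<in> {1..r}" "x \<in> {1..n i}" "y = offset i + x"
proof -
  have "\<exists>i\<in>{1..s}. \<exists>x\<in>{1..n i}. y = offset i + x" if "y \<in> {1..(\<Sum>i\<in>{1..s}. n i)}" for s
    using that
  proof (induction s)
    case (Suc s)
    have eq: "offset (Suc s) = (\<Sum>i\<in>{1..s}. n i)"
      by (simp add: offset_def atLeastLessThanSuc_atLeastAtMost)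
    show ?case
    proof (cases "y \<le> (\<Sum>i\<in>{1..s}. n i)")
      case True
      then show ?thesis using Suc by fastforce
    next
      case False
      then have "y - offset (Suc s) \<in> {1..n (Suc s)}" "y = offset (Suc s) + (y - offset (Suc s))"
        using Suc.prems eq by auto
      then show ?thesis
        by (intro bexI[of _ "Suc s"] bexI[of _ "y - offset (Suc s)"]) auto
    qed
  qed simp
  then show thesis using assms that by blast
qed

lemma block_subset: "block i X \<subseteq> {1..n i}"
  by (auto simp: block_def)

lemma join_blocks_offset: "join_blocks r n S = (\<Union>i\<in>{1..r}. (\<lambda>x. offset i + x) ` S i)"
  by (simp add: join_blocks_def offset_def)

lemma block_join:
  assumes "i \<in> {1..r}" "\<And>l. l \<in> {1..r} \<Longrightarrow> S l \<subseteq> {1..n l}"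
  shows "block i (join_blocks r n S) = S i"
proof (intro subset_antisym subsetI)
  fix x assume "x \<in> block i (join_blocks r n S)"
  then obtain l y where l: "l \<in> {1..r}" "y \<in> S l" "offset i + x = offset l + y" "x \<in> {1..n i}"
    by (auto simp: block_def join_blocks_offset)
  then have "i = l"
    using offset_unique[of i l x y] assms by blast
  then show "x \<in> S i" using l by simp
qed (use assms in \<open>force simp: block_def join_blocks_offset\<close>)

lemma join_block:
  assumes "X \<subseteq> {1..width}"
  shows "join_blocks r n (\<lambda>i. block i X) = X"
proof (intro subset_antisym subsetI)
  fix y assume y: "y \<in> X"
  then obtain i x where "i \<in> {1..r}" "x \<in> {1..n i}" "y = offset i + x"
    using offset_cover[of y] assms by blast
  then show "y \<in> join_blocks r n (\<lambda>i. block i X)"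
    using y by (auto simp: join_blocks_offset block_def)
qed (auto simp: join_blocks_offset block_def)

lemma join_blocks_subset:
  assumes "\<And>l. l \<in> {1..r} \<Longrightarrow> S l \<subseteq> {1..n l}"
  shows "join_blocks r n S \<subseteq> {1..width}"
proof
  fix y assume "y \<in> join_blocks r n S"
  then obtain i x where "i \<in> {1..r}" "x \<in> S i" "y = offset i + x"
    by (auto simp: join_blocks_offset)
  then show "y \<in> {1..width}"
    using assms offset_le_total by blast
qed

lemma block_mono_iff:
  assumes "X \<subseteq> {1..width}"
  shows "X \<subseteq> Y \<longleftrightarrow> (\<forall>i\<in>{1..r}. block i X \<subseteq> block i Y)"
proof
  assume R: "\<forall>i\<in>{1..r}. block i X \<subseteq> block i Y"
  show "X \<subseteq> Y"
  proof
    fix y assume y: "y \<in> X"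
    then obtain i x where "i \<in> {1..r}" "x \<in> {1..n i}" "y = offset i + x"
      using offset_cover[of y] assms by blast
    then show "y \<in> Y" using y R by (auto simp: block_def)
  qed
qed (auto simp: block_def)

lemma block_eqI:
  assumes "X \<subseteq> {1..width}" "Y \<subseteq> {1..width}" "\<And>i. i \<in> {1..r} \<Longrightarrow> block i X = block i Y"
  shows "X = Y"
  using block_mono_iff[OF assms(1), of Y] block_mono_iff[OF assms(2), of X] assms(3)
  by (intro subset_antisym) auto

lemma card_blocks:
  assumes "X \<subseteq> {1..width}"
  shows "card X = (\<Sum>i\<in>{1..r}. card (block i X))"
proof -
  have "card (join_blocks r n (\<lambda>i. block i X)) = (\<Sum>i\<in>{1..r}. card ((\<lambda>x. offset i + x) ` block i X))"
    unfolding join_blocks_offset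
  proof (rule card_UN_disjoint)
    show "\<forall>i\<in>{1..r}. \<forall>j\<in>{1..r}. i \<noteq> j \<longrightarrow>
        (+) (offset i) ` block i X \<inter> (+) (offset j) ` block j X = {}"
      using offset_unique block_subset by blast
  qed (auto simp: block_def)
  also have "\<dots> = (\<Sum>i\<in>{1..r}. card (block i X))"
    by (intro sum.cong card_image) auto
  finally show ?thesis using join_block[OF assms] by simp
qed

lemma block_all: "X = {1..width} \<Longrightarrow> i \<in> {1..r} \<Longrightarrow> block i X = {1..n i}"
  using offset_le_total by (auto simp: block_def)

lemma block_empty: "block i {} = {}"
  by (auto simp: block_def)

text \<open>Membership is a condition on each block separately, which suits the passage to
  coordinates.\<close>

definition block_cuboid :: "(nat \<Rightarrow> nat set set) \<Rightarrow> nat set set" where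
  "block_cuboid A = {X. X \<subseteq> {1..width} \<and> (\<forall>i\<in>{1..r}. block i X \<in> A i)}"

lemma block_cuboid_subset: "block_cuboid A \<subseteq> cuboid r n A"
proof
  fix X assume X: "X \<in> block_cuboid A"
  have "X = join_blocks r n (restrict (\<lambda>i. block i X) {1..r})"
    using join_block[of X] X by (simp add: block_cuboid_def join_blocks_offset)
  then show "X \<in> cuboid r n A"
    using X by (auto simp: cuboid_def block_cuboid_def)
qed

text \<open>The height of each block above the bottom of its chain; the value 0 off
  \<open>{1..r}\<close> is the one that \<open>box\<close> prescribes.\<close>

definition coord :: "(nat \<Rightarrow> nat set set) \<Rightarrow> nat set \<Rightarrow> nat \<Rightarrow> nat" where
  "coord A X i = (if i \<in> {1..r} then card (block i X) - level (n i) (A i) else 0)"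

context
  fixes A
  assumes A: "\<And>i. i \<in> {1..r} \<Longrightarrow> symmetric_chain (n i) (A i)"
begin

lemma coord_level:
  assumes "X \<in> block_cuboid A" "i \<in> {1..r}"
  shows "card (block i X) = level (n i) (A i) + coord A X i"
  using symmetric_chain_card_range(1)[OF A[OF assms(2)], of "block i X"] assms
  by (simp add: coord_def block_cuboid_def)

lemma coord_le_iff:
  assumes "X \<in> block_cuboid A" "Y \<in> block_cuboid A"
  shows "coord A X \<le> coord A Y \<longleftrightarrow> X \<subseteq> Y"
proof -
  have "coord A X i \<le> coord A Y i \<longleftrightarrow> block i X \<subseteq> block i Y" if "i \<in> {1..r}" for i
    using symmetric_chain_le_iff[OF A[OF that], of "block i X" "block i Y"] assms that
      coord_level[OF assms(1) that] coord_level[OF assms(2) that]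
    by (auto simp: block_cuboid_def)
  moreover have "coord A X i \<le> coord A Y i" if "i \<notin> {1..r}" for i
    using that unfolding coord_def by (simp del: atLeastAtMost_iff)
  ultimately have "coord A X \<le> coord A Y \<longleftrightarrow> (\<forall>i\<in>{1..r}. block i X \<subseteq> block i Y)"
    unfolding le_fun_def by blast
  then show ?thesis
    using block_mono_iff[of X Y] assms by (simp add: block_cuboid_def)
qed

lemma coord_bij: "bij_betw (coord A) (block_cuboid A) (box {1..r} (\<lambda>i. card (A i) - 1))"
  unfolding bij_betw_def
proof
  show "inj_on (coord A) (block_cuboid A)"
  proof (rule inj_onI)
    fix X Y assume "X \<in> block_cuboid A" "Y \<in> block_cuboid A" "coord A X = coord A Y"
    then show "X = Y"
      using coord_le_iff[of X Y] coord_le_iff[of Y X] by (intro subset_antisym) auto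
  qed
  show "coord A ` block_cuboid A = box {1..r} (\<lambda>i. card (A i) - 1)"
  proof (intro subset_antisym subsetI)
    fix z assume "z \<in> coord A ` block_cuboid A"
    then obtain X where X: "X \<in> block_cuboid A" "z = coord A X" by blast
    have "coord A X i \<le> card (A i) - 1" if i: "i \<in> {1..r}" for i
    proof -
      have "block i X \<in> A i" using X(1) i by (simp add: block_cuboid_def)
      then show ?thesis
        using symmetric_chain_card_range(2)[OF A[OF i]] coord_level[OF X(1) i] by fastforce
    qed
    then show "z \<in> box {1..r} (\<lambda>i. card (A i) - 1)"
      using X(2) by (simp add: box_def coord_def)
  next
    fix z assume z: "z \<in> box {1..r} (\<lambda>i. card (A i) - 1)"
    have "\<exists>S. S \<in> A i \<and> card S = level (n i) (A i) + z i" if "i \<in> {1..r}" for i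
      using symmetric_chain_obtain[OF A[OF that], of "z i"] z that by (force simp: box_def)
    then obtain S where S: "\<And>i. i \<in> {1..r} \<Longrightarrow> S i \<in> A i \<and> card (S i) = level (n i) (A i) + z i"
      by metis
    have sub: "S i \<subseteq> {1..n i}" if "i \<in> {1..r}" for i
      using S[OF that] symmetric_chain_subset[OF A[OF that]] by blast
    define X where "X = join_blocks r n S"
    have block: "block i X = S i" if "i \<in> {1..r}" for i
      using block_join[OF that sub] by (simp add: X_def)
    have "X \<in> block_cuboid A"
      using join_blocks_subset[OF sub] S block by (simp add: block_cuboid_def X_def)
    moreover have "coord A X = z"
      using z S block by (intro ext) (auto simp: coord_def box_def)
    ultimately show "z \<in> coord A ` block_cuboid A" by blast
  qed
qed

text \<open>The decomposition is pulled back along \<open>coord\<close>. Sizes exceed ranks by the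
  sum of the levels, and twice this sum plus the sum of the sides is the width, so symmetric chains
  stay symmetric.\<close>

lemma cuboid_scd:
  assumes "avoiding_scd {1..r} (\<lambda>i. card (A i) - 1) R (box {1..r} (\<lambda>i. card (A i) - 1))"
  obtains Q where "partition_on (block_cuboid A) Q" "\<And>C. C \<in> Q \<Longrightarrow> symmetric_chain width C"
    "\<And>C X Y. C \<in> Q \<Longrightarrow> X \<in> C \<Longrightarrow> Y \<in> C \<Longrightarrow> \<not> R (coord A X) (coord A Y)"
proof -
  let ?b = "\<lambda>i. card (A i) - 1"
  let ?B = "box {1..r} ?b"
  obtain P where P: "partition_on ?B P"
    and chain: "\<And>C. C \<in> P \<Longrightarrow> box_chain {1..r} ?b C"
    and R: "\<And>C x y. C \<in> P \<Longrightarrow> x \<in> C \<Longrightarrow> y \<in> C \<Longrightarrow> \<not> R x y"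
    using assms unfolding avoiding_scd_def by blast
  define g where "g = inv_into (block_cuboid A) (coord A)"
  have g: "bij_betw g ?B (block_cuboid A)"
    unfolding g_def by (rule bij_betw_inv_into[OF coord_bij])
  have coord_g: "coord A (g z) = z" if "z \<in> ?B" for z
    using bij_betw_inv_into_right[OF coord_bij that] by (simp add: g_def)
  have g_in: "g z \<in> block_cuboid A" if "z \<in> ?B" for z
    using g that by (auto simp: bij_betw_def)
  have sub: "C \<subseteq> ?B" if "C \<in> P" for C
    using P that by (auto simp: partition_on_def)
  let ?L = "\<Sum>i\<in>{1..r}. level (n i) (A i)"
  have width_eq: "2 * ?L + sum ?b {1..r} = width"
    unfolding sum_distrib_left sum.distrib[symmetric]
    by (intro sum.cong) (use symmetric_chain_level(1)[OF A] in auto)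
  have card_g: "card (g z) = ?L + sum z {1..r}" if "z \<in> ?B" for z
  proof -
    have "card (g z) = (\<Sum>i\<in>{1..r}. card (block i (g z)))"
      using card_blocks[of "g z"] g_in[OF that] by (simp add: block_cuboid_def)
    also have "\<dots> = (\<Sum>i\<in>{1..r}. level (n i) (A i) + z i)"
      using coord_level[OF g_in[OF that]] coord_g[OF that] by (intro sum.cong) auto
    finally show ?thesis by (simp add: sum.distrib)
  qed
  have "symmetric_chain width (g ` C)" if C: "C \<in> P" for C
  proof -
    obtain j where j: "2 * j \<le> sum ?b {1..r}" "bij_betw (\<lambda>z. sum z {1..r}) C {j..sum ?b {1..r} - j}"
      using chain[OF C] by (auto simp: box_chain_def)
    have "bij_betw (\<lambda>t. ?L + t) {j..sum ?b {1..r} - j} {?L + j..width - (?L + j)}"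
      by (rule bij_betw_byWitness[where f' = "\<lambda>t. t - ?L"]) (use width_eq j in auto)
    from bij_betw_trans[OF j(2) this] have "bij_betw (\<lambda>z. ?L + sum z {1..r}) C {?L + j..width - (?L + j)}"
      by (simp add: o_def)
    then have "bij_betw (\<lambda>z. card (g z)) C {?L + j..width - (?L + j)}"
      by (rule bij_betw_cong[THEN iffD1, rotated]) (use card_g sub[OF C] in force)
    then have "bij_betw card (g ` C) {?L + j..width - (?L + j)}"
      unfolding bij_betw_def inj_on_def image_image by auto
    moreover have "2 * (?L + j) \<le> width" using width_eq j by simp
    moreover have "chain_subset (g ` C)"
      unfolding chain_subset_def
    proof (intro ballI)
      fix X Y assume "X \<in> g ` C" "Y \<in> g ` C"
      then obtain x y where xy: "x \<in> C" "y \<in> C" "X = g x" "Y = g y" by blast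
      then have "x \<le> y \<or> y \<le> x"
        using chain[OF C] unfolding box_chain_def by blast
      moreover have "x \<in> ?B" "y \<in> ?B" using xy sub[OF C] by blast+
      ultimately show "X \<subseteq> Y \<or> Y \<subseteq> X"
        using coord_le_iff[OF g_in g_in] coord_g xy by metis
    qed
    moreover have "g ` C \<subseteq> boolean_lattice width"
      using g_in sub[OF C] by (auto simp: block_cuboid_def boolean_lattice_def)
    ultimately show ?thesis
      unfolding symmetric_chain_def by blast
  qed
  moreover have "\<not> R (coord A X) (coord A Y)" if C: "C \<in> P" and XY: "X \<in> g ` C" "Y \<in> g ` C" for C X Y
  proof -
    obtain x y where "x \<in> C" "y \<in> C" "X = g x" "Y = g y" using XY by blast
    moreover from this have "x \<in> ?B" "y \<in> ?B" using sub[OF C] by blast+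
    ultimately show ?thesis using R[OF C] coord_g by simp
  qed
  moreover have "partition_on (block_cuboid A) ((`) g ` P)"
    using partition_on_inj_image[OF P, of g] g partition_onD3[OF P]
    by (simp add: bij_betw_def image_iff)
  ultimately show thesis
    using that[of "(`) g ` P"] by blast
qed

end

end

section \<open>Products of almost orthogonal decompositions\<close>

text \<open>Two distinct common points exceed the bound 1, so the exceptional case applies;
  \<open>n \<ge> 1\<close> makes \<open>{}\<close> and \<open>{1..n}\<close> distinct, and they
  exhaust the intersection.\<close>

lemma almost_orthogonal_inter:
  assumes "almost_orthogonal n \<F> \<G>" "A \<in> \<F>" "B \<in> \<G>" "symmetric_chain n A" "n \<ge> 1"
    and XY: "X \<in> A \<inter> B" "Y \<in> A \<inter> B" "X \<noteq> Y"
  shows "A \<inter> B = {{}, {1..n}}"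
proof -
  have "A \<subseteq> Pow {1..n}"
    using assms(4) by (auto simp: symmetric_chain_def boolean_lattice_def)
  then have fin: "finite (A \<inter> B)"
    using finite_subset by blast
  then have "card {X, Y} \<le> card (A \<inter> B)"
    using XY by (intro card_mono) auto
  then have "\<not> card (A \<inter> B) \<le> 1"
    using XY(3) by simp
  then have "{{}, {1..n}} \<subseteq> A \<inter> B" "card (A \<inter> B) = 2"
    using assms(1-3) unfolding almost_orthogonal_def by (meson le_inf_iff)+
  moreover have "card {{}, {1..n}} = 2"
    using assms(5) by auto
  ultimately show ?thesis
    using fin card_subset_eq[of "A \<inter> B" "{{}, {1..n}}"] by auto
qed

lemma SCD_obtain:
  assumes "SCD n \<F>" "X \<subseteq> {1..n}"
  obtains C where "C \<in> \<F>" "X \<in> C" "symmetric_chain n C"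
proof -
  have "X \<in> \<Union>\<F>"
    using assms by (auto simp: SCD_def partition_on_def boolean_lattice_def)
  then show thesis
    using that assms(1) by (auto simp: SCD_def)
qed

lemma SCD_unique:
  assumes "SCD n \<F>" "C \<in> \<F>" "C' \<in> \<F>" "X \<in> C" "X \<in> C'"
  shows "C = C'"
  using assms disjointD[of \<F> C C'] by (auto simp: SCD_def partition_on_def)

lemma three_SCDs_ge_4:
  assumes F: "pairwise_almost_orthogonal_SCDs n k F" and "k \<ge> 3" "n \<ge> 2"
  shows "n \<ge> 4"
proof (rule ccontr)
  assume "\<not> n \<ge> 4"
  \<comment> \<open>For \<open>n < 4\<close> this size lies in the lower half and leaves just two
    points outside \<open>?X\<close>, hence two possible successors.\<close>
  define p where "p = n - 2"
  then have p: "n = p + 2" "p \<le> 1"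
    using assms(3) \<open>\<not> n \<ge> 4\<close> by auto
  let ?X = "{1..p}"
  have "\<exists>C y. C \<in> F j \<and> symmetric_chain n C \<and> ?X \<in> C \<and> insert y ?X \<in> C \<and> y \<in> {p + 1, p + 2}"
    if "j \<in> {1..k}" for j
  proof -
    have "SCD n (F j)"
      using F that by (simp add: pairwise_almost_orthogonal_SCDs_def)
    then obtain C where C: "C \<in> F j" "?X \<in> C" "symmetric_chain n C"
      using SCD_obtain[of n "F j" ?X] p by auto
    have "level n C \<le> p"
      using symmetric_chain_card_range(1)[OF C(3,2)] by simp
    then have "p + 1 - level n C \<le> card C - 1" "level n C + (p + 1 - level n C) = p + 1"
      using symmetric_chain_level(1)[OF C(3)] p by auto
    then obtain Y where Y: "Y \<in> C" "card Y = p + 1"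
      using symmetric_chain_obtain[OF C(3), of "p + 1 - level n C"] by metis
    have XY: "?X \<subseteq> Y" "Y \<subseteq> {1..n}"
      using symmetric_chain_le_iff[OF C(3,2) Y(1)] Y symmetric_chain_subset[OF C(3)] by auto
    then have "card (Y - ?X) = 1"
      using Y(2) by (simp add: card_Diff_subset)
    then obtain y where y: "Y - ?X = {y}"
      by (auto simp: card_1_singleton_iff)
    then have "Y = insert y ?X" using XY by blast
    moreover have "y \<in> {p + 1, p + 2}"
    proof -
      have "y \<in> Y" "y \<notin> ?X" using y by blast+
      then show ?thesis using XY(2) p(1) by auto
    qed
    ultimately show ?thesis using C Y by blast
  qed
  then obtain C y where C: "\<And>j. j \<in> {1..k} \<Longrightarrow> C j \<in> F j \<and> symmetric_chain n (C j) \<and>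
      ?X \<in> C j \<and> insert (y j) ?X \<in> C j \<and> y j \<in> {p + 1, p + 2}"
    by metis
  have k: "1 \<in> {1..k}" "2 \<in> {1..k}" "3 \<in> {1..k}" using assms(2) by auto
  \<comment> \<open>Pigeonhole: two of three colours share \<open>?X\<close> and its successor. The
    successor would have to be \<open>{1..n}\<close>, but it has only \<open>n - 1\<close>
    elements.\<close>
  then have "y 1 = y 2 \<or> y 1 = y 3 \<or> y 2 = y 3"
    using C[of 1] C[of 2] C[of 3] by auto
  then have "\<exists>j\<in>{1..k}. \<exists>j'\<in>{1..k}. j \<noteq> j' \<and> y j = y j'"
  proof (elim disjE)
    assume "y 1 = y 2"
    then show ?thesis using k by (intro bexI[of _ 1] bexI[of _ 2]) auto
  next
    assume "y 1 = y 3"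
    then show ?thesis using k by (intro bexI[of _ 1] bexI[of _ 3]) auto
  next
    assume "y 2 = y 3"
    then show ?thesis using k by (intro bexI[of _ 2] bexI[of _ 3]) auto
  qed
  then obtain j j' where j: "j \<in> {1..k}" "j' \<in> {1..k}" "j \<noteq> j'" "y j = y j'"
    by blast
  have "almost_orthogonal n (F j) (F j')"
    using F j by (simp add: pairwise_almost_orthogonal_SCDs_def)
  moreover have "y j \<notin> ?X"
    using C[OF j(1)] by auto
  then have "?X \<noteq> insert (y j) ?X" by blast
  ultimately have "C j \<inter> C j' = {{}, {1..n}}"
    using C[OF j(1)] C[OF j(2)] j(4) p
    by (intro almost_orthogonal_inter[of n "F j" "F j'" _ _ ?X "insert (y j) ?X"]) auto
  moreover have "insert (y j) ?X \<in> C j \<inter> C j'"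
    using C[OF j(1)] C[OF j(2)] j(4) by simp
  ultimately have "insert (y j) ?X \<in> {{}, {1..n}}" by (simp only:)
  then have "insert (y j) ?X = {1..n}" by blast
  then have "card (insert (y j) ?X) = n" by simp
  moreover have "card (insert (y j) ?X) = p + 1"
    using C[OF j(1)] by auto
  ultimately show False using p by simp
qed

text \<open>A clash expressed by subsets of the cube. It mentions no chains, so the same pair can be
  examined in cuboids of both colours.\<close>

definition corner_pair :: "nat \<Rightarrow> (nat \<Rightarrow> nat) \<Rightarrow> nat set \<Rightarrow> nat set \<Rightarrow> bool" where
  "corner_pair r n X Y \<longleftrightarrow> X \<subset> Y \<and>
    (\<forall>i\<in>{1..r}. block n i X \<noteq> block n i Y \<longrightarrow> block n i X = {} \<and> block n i Y = {1..n i})"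

text \<open>The two unavoidable kinds of clash; a factor is full when it contains \<open>{}\<close>.
  \<open>T\<close> is the end of the 2-element factor \<open>A d\<close> to which clashes of the
  second kind are confined.\<close>

definition exceptional_pair ::
    "nat \<Rightarrow> (nat \<Rightarrow> nat) \<Rightarrow> (nat \<Rightarrow> nat set set) \<Rightarrow> nat \<Rightarrow> nat set \<Rightarrow> nat set \<Rightarrow> nat set \<Rightarrow> bool" where
  "exceptional_pair r n A d T X Y \<longleftrightarrow>
    {i \<in> {1..r}. block n i X \<noteq> block n i Y} = {i \<in> {1..r}. {} \<in> A i} \<and>
    ((\<forall>i\<in>{1..r}. {} \<notin> A i \<longrightarrow> card (A i) = 1) \<or>
     card {i \<in> {1..r}. {} \<in> A i} = 1 \<and> d \<in> {1..r} \<and> {} \<notin> A d \<and> card (A d) = 2 \<and>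
       (T \<in> A d \<longrightarrow> block n d X = T))"

text \<open>Translates \<open>box_scd\<close> to subsets: in a full chain \<open>{}\<close> and
  \<open>{1..n i}\<close> have coordinates 0 and \<open>card (A i) - 1\<close>, so a corner pair is
  a clash on the set of blocks where its members differ.\<close>

lemma cuboid_chains:
  fixes A r n
  assumes A: "\<And>i. i \<in> {1..r} \<Longrightarrow> symmetric_chain (n i) (A i)"
    and n: "\<And>i. i \<in> {1..r} \<Longrightarrow> n i \<ge> 4"
    and d: "card {i \<in> {1..r}. {} \<in> A i} = 1 \<Longrightarrow> \<forall>i\<in>{1..r}. {} \<notin> A i \<longrightarrow> card (A i) \<le> 2 \<Longrightarrow>
      \<exists>i\<in>{1..r}. {} \<notin> A i \<and> card (A i) = 2 \<Longrightarrow> d \<in> {1..r} \<and> {} \<notin> A d \<and> card (A d) = 2"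
  shows "\<exists>Q. partition_on (block_cuboid r n A) Q \<and> (\<forall>C\<in>Q. symmetric_chain (width r n) C \<and>
    (\<forall>X\<in>C. \<forall>Y\<in>C. corner_pair r n X Y \<longrightarrow> exceptional_pair r n A d T X Y))"
proof -
  let ?K = "{1..r}" and ?b = "\<lambda>i. card (A i) - 1"
  define M where "M = {i \<in> ?K. {} \<in> A i}"
  \<comment> \<open>The coordinate of \<open>T\<close> in the 2-element chain \<open>A d\<close>;
    the default 0 keeps \<open>e \<le> 1\<close> in all other cases.\<close>
  define e where "e = (if d \<in> ?K \<and> T \<in> A d \<and> card (A d) = 2 then card T - level (n d) (A d) else 0)"
  have A1: "card (A i) \<ge> 1" if "i \<in> ?K" for i
    using symmetric_chain_level(3)[OF A[OF that]] .
  have bM: "?b i = n i" "level (n i) (A i) = 0" if "i \<in> M" for i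
    using that symmetric_chain_empty_iff(1)[OF A, of i] symmetric_chain_level(1)[OF A, of i]
    by (auto simp: M_def)
  have e1: "e \<le> 1"
    using symmetric_chain_card_range(2)[OF A, of d T] by (auto simp: e_def)
  define bad where "bad = (\<lambda>x y. \<exists>I\<in>Pow M - {{}}.
    (\<forall>i\<in>?K. if i \<in> I then x i = 0 \<and> y i = ?b i else x i = (y i :: nat)) \<and>
    \<not> (I = M \<and> ((\<forall>i\<in>?K - M. ?b i = 0) \<or> card M = 1 \<and> d \<in> ?K - M \<and> ?b d = 1 \<and> x d = e)))"
  have "avoiding_scd ?K ?b bad (box ?K ?b)"
    unfolding bad_def
  proof (rule box_scd)
    show "d \<in> ?K - M \<and> ?b d = 1"
      if "card M = 1" "\<forall>i\<in>?K - M. ?b i \<le> 1" "\<exists>i\<in>?K - M. ?b i = 1"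
    proof -
      have "\<forall>i\<in>?K. {} \<notin> A i \<longrightarrow> card (A i) \<le> 2"
        using that(2) by (force simp: M_def)
      moreover have "\<exists>i\<in>?K. {} \<notin> A i \<and> card (A i) = 2"
        using that(3) by (force simp: M_def)
      ultimately show ?thesis using d that(1) by (simp add: M_def)
    qed
    show "4 \<le> ?b i" if "i \<in> M" for i
      using bM(1)[OF that] n that by (simp add: M_def)
  qed (use e1 in \<open>auto simp: M_def\<close>)
  then obtain Q where Q: "partition_on (block_cuboid r n A) Q"
    "\<And>C. C \<in> Q \<Longrightarrow> symmetric_chain (width r n) C"
    "\<And>C X Y. C \<in> Q \<Longrightarrow> X \<in> C \<Longrightarrow> Y \<in> C \<Longrightarrow> \<not> bad (coord r n A X) (coord r n A Y)"
    using cuboid_scd[of r n A bad] A by blast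
  have "exceptional_pair r n A d T X Y"
    if C: "C \<in> Q" "X \<in> C" "Y \<in> C" and corner: "corner_pair r n X Y" for C X Y
  proof -
    have "X \<subset> Y"
      and ends: "\<And>i. i \<in> ?K \<Longrightarrow> block n i X \<noteq> block n i Y \<Longrightarrow> block n i X = {} \<and> block n i Y = {1..n i}"
      using corner by (auto simp: corner_pair_def)
    let ?I = "{i \<in> ?K. block n i X \<noteq> block n i Y}"
    have cub: "X \<in> block_cuboid r n A" "Y \<in> block_cuboid r n A"
      using Q(1) C by (auto simp: partition_on_def)
    then have sub: "X \<subseteq> {1..width r n}" "Y \<subseteq> {1..width r n}"
      and blocks: "\<And>i. i \<in> ?K \<Longrightarrow> block n i X \<in> A i \<and> block n i Y \<in> A i"
      by (auto simp: block_cuboid_def)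
    have "?I \<noteq> {}"
      using block_eqI[OF sub] \<open>X \<subset> Y\<close> by blast
    moreover have IM: "?I \<subseteq> M"
      using ends blocks by (force simp: M_def)
    moreover have "if i \<in> ?I then coord r n A X i = 0 \<and> coord r n A Y i = ?b i
        else coord r n A X i = coord r n A Y i" if i: "i \<in> ?K" for i
    proof (cases "i \<in> ?I")
      case True
      then show ?thesis
        using ends[OF i] bM[of i] IM i by (auto simp: coord_def)
    qed (use i in \<open>simp add: coord_def\<close>)
    ultimately have I: "?I = M \<and> ((\<forall>i\<in>?K - M. ?b i = 0) \<or>
        card M = 1 \<and> d \<in> ?K - M \<and> ?b d = 1 \<and> coord r n A X d = e)"
      using Q(3)[OF C] unfolding bad_def by blast
    \<comment> \<open>A chain has only one member of each size, so the coordinate determines the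
      block.\<close>
    have "block n d X = T" if "T \<in> A d" "d \<in> ?K" "card (A d) = 2" "coord r n A X d = e"
    proof -
      have "card T = card (block n d X)"
        using coord_level[OF A cub(1) that(2)] that symmetric_chain_card_range(1)[OF A that(1)]
        by (auto simp: e_def)
      then show ?thesis
        using symmetric_chain_le_iff[OF A[OF that(2)]] blocks[OF that(2)] that(1) by (metis order_refl subset_antisym)
    qed
    moreover have "(\<forall>i\<in>?K - M. ?b i = 0) \<Longrightarrow> \<forall>i\<in>?K. {} \<notin> A i \<longrightarrow> card (A i) = 1"
      using A1 by (force simp: M_def)
    moreover have "card (A d) = 2" if "?b d = 1" using that by simp
    ultimately show ?thesis
      using I unfolding M_def exceptional_pair_def by blast
  qed
  with Q(1,2) show ?thesis by blast
qed

lemma finite_two_element_chains: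
  assumes "pairwise_almost_orthogonal_SCDs n k F"
  shows "finite (two_element_chains k F)"
proof (rule finite_subset)
  show "two_element_chains k F \<subseteq> Pow (Pow {1..n})"
    using assms by (auto simp: two_element_chains_def pairwise_almost_orthogonal_SCDs_def SCD_def
        symmetric_chain_def boolean_lattice_def)
qed simp

text \<open>Finiteness of \<open>E\<close> makes the set of out-neighbours finite, so that
  \<open>card\<close> at most 1 really excludes two arcs.\<close>

lemma orientation_tail_unique:
  assumes D: "orientation E D" "finite E" and out: "\<forall>v\<in>\<Union>E. card (D `` {v}) \<le> 1"
    and "(u, v) \<in> D" "(u, v') \<in> D"
  shows "v = v'"
proof -
  have bij: "bij_betw (\<lambda>(u, v). {u, v}) D E"
    using D(1) by (simp add: orientation_def)
  then have "finite D"
    using D(2) bij_betw_finite by blast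
  then have "finite (D `` {u})" by (rule finite_Image)
  have "(\<lambda>(u, v). {u, v}) (u, v) \<in> E"
    using bij assms(4) unfolding bij_betw_def by blast
  then have "card (D `` {u}) \<le> 1"
    using out by auto
  with \<open>finite (D `` {u})\<close> show ?thesis
    using assms(4,5) by (auto simp: card_le_Suc0_iff_eq)
qed

text \<open>Each block of a subset lies in exactly one chain of its factor, so each subset lies in
  exactly one cuboid.\<close>

lemma partition_on_UN_cuboids:
  assumes F: "\<And>i. i \<in> {1..r} \<Longrightarrow> SCD (n i) (G i)"
    and Q: "\<And>A. A \<in> (\<Pi>\<^sub>E i\<in>{1..r}. G i) \<Longrightarrow> partition_on (block_cuboid r n A) (Q A)"
  shows "partition_on (boolean_lattice (width r n)) (\<Union>A\<in>(\<Pi>\<^sub>E i\<in>{1..r}. G i). Q A)"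
    (is "partition_on _ (\<Union>A\<in>?P. Q A)")
proof (rule partition_onI)
  have sub: "C \<subseteq> block_cuboid r n A" if "A \<in> ?P" "C \<in> Q A" for A C
    using Q[OF that(1)] that(2) by (auto simp: partition_on_def)
  show "\<Union>(\<Union>A\<in>?P. Q A) = boolean_lattice (width r n)"
  proof (intro subset_antisym subsetI)
    fix X assume X: "X \<in> boolean_lattice (width r n)"
    have "\<exists>C. C \<in> G i \<and> block n i X \<in> C" if "i \<in> {1..r}" for i
      using SCD_obtain[OF F[OF that], of "block n i X"] block_subset[of n i X] by blast
    then obtain A where A: "\<And>i. i \<in> {1..r} \<Longrightarrow> A i \<in> G i \<and> block n i X \<in> A i"
      by metis
    let ?A = "restrict A {1..r}"
    have "?A \<in> ?P" using A by auto
    moreover have "X \<in> block_cuboid r n ?A"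
      using A X by (auto simp: block_cuboid_def boolean_lattice_def)
    ultimately show "X \<in> \<Union>(\<Union>A\<in>?P. Q A)"
      using partition_onD1[OF Q[of ?A]] by blast
  next
    fix X assume "X \<in> \<Union>(\<Union>A\<in>?P. Q A)"
    then obtain A C where "A \<in> ?P" "C \<in> Q A" "X \<in> C" by blast
    then have "X \<in> block_cuboid r n A" using sub by blast
    then show "X \<in> boolean_lattice (width r n)"
      by (simp add: block_cuboid_def boolean_lattice_def)
  qed
  show "disjnt C C'" if C: "C \<in> (\<Union>A\<in>?P. Q A)" "C' \<in> (\<Union>A\<in>?P. Q A)" "C \<noteq> C'" for C C'
  proof (rule ccontr)
    assume "\<not> disjnt C C'"
    then obtain X where X: "X \<in> C" "X \<in> C'" by (auto simp: disjnt_def)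
    obtain A A' where A: "A \<in> ?P" "C \<in> Q A" "A' \<in> ?P" "C' \<in> Q A'" using C by blast
    have "A i = A' i" if "i \<in> {1..r}" for i
    proof (rule SCD_unique[OF F[OF that]])
      show "block n i X \<in> A i" "block n i X \<in> A' i"
        using sub[OF A(1,2)] sub[OF A(3,4)] X that by (auto simp: block_cuboid_def)
    qed (use A that in auto)
    then have "A = A'" using A by (intro PiE_ext) auto
    then show False
      using disjointD[OF partition_onD2[OF Q[OF A(1)]], of C C'] A C(3) X by blast
  qed
  show "{} \<notin> (\<Union>A\<in>?P. Q A)"
    using partition_onD3[OF Q] by blast
qed

theorem theorem3p3:
  fixes k r :: nat
    and n :: "nat \<Rightarrow> nat"
    and F :: "nat \<Rightarrow> nat \<Rightarrow> nat set set set"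
  assumes "k \<ge> 3" and "r \<ge> 1"
    and "\<forall>i\<in>{1..r}. n i \<ge> 2"
    and "\<forall>i\<in>{1..r}. pairwise_almost_orthogonal_SCDs (n i) k (F i)"
    and "\<forall>i\<in>{1..r}. even (n i) \<longrightarrow> good (n i) k (F i)"
    and "(\<forall>i\<in>{1..r}. odd (n i) \<longrightarrow> good (n i) k (F i)) \<or>
         card {i \<in> {1..r}. odd (n i) \<and> good (n i) k (F i)} \<ge> 2"
  shows "\<exists>H :: nat \<Rightarrow> nat set set set.
           pairwise_almost_orthogonal_SCDs (\<Sum>i\<in>{1..r}. n i) k H \<and>
           (\<forall>j\<in>{1..k}. \<forall>C\<in>H j. \<exists>A.
              (\<forall>i\<in>{1..r}. A i \<in> F i j) \<and> C \<subseteq> cuboid r n A)"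
proof -
  let ?K = "{1..r}"
  have n4: "n i \<ge> 4" if "i \<in> ?K" for i
    using three_SCDs_ge_4 assms(1,3,4) that by blast
  have scd: "SCD (n i) (F i j)" if "i \<in> ?K" "j \<in> {1..k}" for i j
    using assms(4) that by (simp add: pairwise_almost_orthogonal_SCDs_def)
  have ao: "almost_orthogonal (n i) (F i j) (F i j')" if "i \<in> ?K" "j \<in> {1..k}" "j' \<in> {1..k}" "j \<noteq> j'" for i j j'
    using assms(4) that by (simp add: pairwise_almost_orthogonal_SCDs_def)
  have chain: "symmetric_chain (n i) C" if "i \<in> ?K" "j \<in> {1..k}" "C \<in> F i j" for i j C
    using scd[OF that(1,2)] that(3) by (simp add: SCD_def)
  have parity: "odd (n i) \<longleftrightarrow> even (card C)" if "i \<in> ?K" "j \<in> {1..k}" "C \<in> F i j" for i j C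
  proof -
    note c = symmetric_chain_level[OF chain[OF that]]
    have "odd (n i) \<longleftrightarrow> odd (card C - 1)"
      using c(1) by (metis dvd_add_right_iff dvd_triv_left)
    then show ?thesis using c(3) by auto
  qed

  \<comment> \<open>Designated odd factors and tails of 2-element chains\<close>
  define good_odd where "good_odd i \<longleftrightarrow> odd (n i) \<and> good (n i) k (F i)" for i
  \<comment> \<open>Either all odd factors are good, and \<open>i\<close> itself serves, or at least
    two are good, and one of them differs from \<open>m\<close>.\<close>
  have "\<exists>d. d \<in> ?K - {m} \<and> good_odd d" if "i \<in> ?K - {m}" "odd (n i)" for i m
  proof (cases "good_odd i")
    case False
    then have "card {i \<in> ?K. good_odd i} \<ge> 2"
      using assms(6) that by (auto simp: good_odd_def)
    then have "\<not> {i \<in> ?K. good_odd i} \<subseteq> {m}"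
      using card_mono[of "{m}" "{i \<in> ?K. good_odd i}"] by auto
    then show ?thesis by blast
  qed (use that in blast)
  note ex_good = this
  \<comment> \<open>The choice depends on \<open>m\<close> alone, so cuboids of different colours
    with the same single full factor get the same designated factor.\<close>
  define \<delta> where "\<delta> m = (SOME d. d \<in> ?K - {m} \<and> good_odd d)" for m
  have \<delta>: "\<delta> m \<in> ?K - {m} \<and> good_odd (\<delta> m)" if "i \<in> ?K - {m}" "odd (n i)" for m i
    unfolding \<delta>_def using ex_good[OF that] by (rule someI_ex)
  have "\<exists>D. orientation (two_element_chains k (F i)) D \<and>
      (\<forall>v\<in>\<Union>(two_element_chains k (F i)). card (D `` {v}) \<le> 1)" if "good_odd i" for i
    using that by (auto simp: good_odd_def good_def)
  then have "\<forall>i. \<exists>D. good_odd i \<longrightarrow> orientation (two_element_chains k (F i)) D \<and>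
      (\<forall>v\<in>\<Union>(two_element_chains k (F i)). card (D `` {v}) \<le> 1)"
    by blast
  from choice[OF this] obtain D where D: "\<And>i. good_odd i \<Longrightarrow> orientation (two_element_chains k (F i)) (D i)"
    "\<And>i. good_odd i \<Longrightarrow> \<forall>v\<in>\<Union>(two_element_chains k (F i)). card (D i `` {v}) \<le> 1"
    by blast
  \<comment> \<open>The source of the arc that orients the edge \<open>C\<close>; clashes will be
    confined to this end.\<close>
  define tail where "tail i C = (SOME u. \<exists>v. (u, v) \<in> D i \<and> C = {u, v})" for i C
  have tail: "\<exists>v. (tail i C, v) \<in> D i \<and> C = {tail i C, v}"
    if "i \<in> ?K" "good_odd i" "j \<in> {1..k}" "C \<in> F i j" "card C = 2" for i j C
  proof -
    have "C \<in> two_element_chains k (F i)"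
      using that by (auto simp: two_element_chains_def)
    then have "C \<in> (\<lambda>(u, v). {u, v}) ` D i"
      using D(1)[OF that(2)] by (simp add: orientation_def bij_betw_def)
    then have "\<exists>u v. (u, v) \<in> D i \<and> C = {u, v}" by auto
    then show ?thesis unfolding tail_def by (rule someI_ex)
  qed

  \<comment> \<open>Full factors and decompositions of the cuboids\<close>
  define M where "M A = {i \<in> ?K. {} \<in> A i}" for A :: "nat \<Rightarrow> nat set set"
  define dd where "dd A = \<delta> (the_elem (M A))" for A
  let ?P = "\<lambda>j. (\<Pi>\<^sub>E i\<in>?K. F i j)"
  have dd: "dd A \<in> ?K \<and> {} \<notin> A (dd A) \<and> good_odd (dd A)"
    if hyps: "j \<in> {1..k}" "A \<in> ?P j" "card (M A) = 1" "i \<in> ?K" "{} \<notin> A i" "card (A i) = 2" for j A i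
  proof -
    obtain m where m: "M A = {m}" using hyps(3) by (auto simp: card_1_singleton_iff)
    have "odd (n i)" using parity[OF hyps(4,1) PiE_mem[OF hyps(2,4)]] hyps(6) by simp
    moreover have "i \<in> ?K - {m}" using m hyps(4,5) by (auto simp: M_def)
    ultimately have "\<delta> m \<in> ?K - {m} \<and> good_odd (\<delta> m)" using \<delta> by blast
    then show ?thesis using m by (auto simp: dd_def M_def)
  qed

  define chains where "chains A Q \<longleftrightarrow> partition_on (block_cuboid r n A) Q \<and>
    (\<forall>C\<in>Q. symmetric_chain (width r n) C \<and> (\<forall>X\<in>C. \<forall>Y\<in>C. corner_pair r n X Y \<longrightarrow>
      exceptional_pair r n A (dd A) (tail (dd A) (A (dd A))) X Y))" for A Q
  have "\<exists>Q. chains A Q" if j: "j \<in> {1..k}" and A: "A \<in> ?P j" for j A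
  proof -
    have Ai: "A i \<in> F i j" if "i \<in> ?K" for i using A that by auto
    have sc: "symmetric_chain (n i) (A i)" if "i \<in> ?K" for i
      using chain[OF that j Ai[OF that]] .
    have designated: "dd A \<in> ?K \<and> {} \<notin> A (dd A) \<and> card (A (dd A)) = 2"
      if one: "card {i \<in> ?K. {} \<in> A i} = 1" and small: "\<forall>i\<in>?K. {} \<notin> A i \<longrightarrow> card (A i) \<le> 2"
        and two: "\<exists>i\<in>?K. {} \<notin> A i \<and> card (A i) = 2"
    proof -
      obtain i where i: "i \<in> ?K" "{} \<notin> A i" "card (A i) = 2" using two by blast
      have "card (M A) = 1" using one by (simp add: M_def)
      then have d: "dd A \<in> ?K" "{} \<notin> A (dd A)" "good_odd (dd A)"
        using dd[OF j A _ i] by blast+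
      \<comment> \<open>Symmetric chains have even size when \<open>n i\<close> is odd, so a size
        from 1 to 2 must be 2.\<close>
      then have "even (card (A (dd A)))" "card (A (dd A)) \<ge> 1" "card (A (dd A)) \<le> 2"
        using parity[OF d(1) j Ai[OF d(1)]] symmetric_chain_level(3)[OF sc[OF d(1)]] small
        by (auto simp: good_odd_def)
      then have "card (A (dd A)) = 2" by (cases "card (A (dd A)) = 1") auto
      then show ?thesis using d by blast
    qed
    show ?thesis
      unfolding chains_def by (rule cuboid_chains) (fact sc n4 designated)+
  qed
  note ex_chains = this
  define Q where "Q j A = (SOME Q. chains A Q)" for j :: nat and A
  have Q: "chains A (Q j A)" if "j \<in> {1..k}" "A \<in> ?P j" for j A
    unfolding Q_def using ex_chains[OF that] by (rule someI_ex)
  define H where "H j = (\<Union>A\<in>?P j. Q j A)" for j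
  let ?N = "width r n"

  have part: "partition_on (block_cuboid r n A) (Q j A)" if "j \<in> {1..k}" "A \<in> ?P j" for j A
    using Q[OF that] by (simp add: chains_def)
  have H_obtain: "\<exists>A. A \<in> ?P j \<and> C \<in> Q j A \<and> C \<subseteq> block_cuboid r n A" if "j \<in> {1..k}" "C \<in> H j" for j C
    using that part by (fastforce simp: H_def partition_on_def)
  have H_scd: "SCD ?N (H j)" if j: "j \<in> {1..k}" for j
    unfolding SCD_def
  proof
    show "partition_on (boolean_lattice ?N) (H j)"
      unfolding H_def by (rule partition_on_UN_cuboids) (use scd part j in auto)
    show "\<forall>C\<in>H j. symmetric_chain ?N C"
      using Q[OF j] by (auto simp: H_def chains_def)
  qed

  \<comment> \<open>Common points of chains of different colours\<close>
  have corners: "X = {} \<and> Y = {1..?N}"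
    if jj: "j \<in> {1..k}" "j' \<in> {1..k}" "j \<noteq> j'" and C: "C \<in> H j" "C' \<in> H j'"
      and X: "X \<in> C \<inter> C'" and Y: "Y \<in> C \<inter> C'" and XY: "X \<subset> Y" for j j' C C' X Y
  proof -
    obtain A where A: "A \<in> ?P j" "C \<in> Q j A" "C \<subseteq> block_cuboid r n A"
      using H_obtain[OF jj(1) C(1)] by blast
    obtain A' where A': "A' \<in> ?P j'" "C' \<in> Q j' A'" "C' \<subseteq> block_cuboid r n A'"
      using H_obtain[OF jj(2) C(2)] by blast
    have Ai: "A i \<in> F i j" "A' i \<in> F i j'" if "i \<in> ?K" for i using A A' that by auto
    have blocks: "block n i X \<in> A i \<inter> A' i" "block n i Y \<in> A i \<inter> A' i" if "i \<in> ?K" for i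
      using A(3) A'(3) X Y that by (auto simp: block_cuboid_def)
    have sub: "X \<subseteq> {1..?N}" "Y \<subseteq> {1..?N}"
      using A(3) X Y by (auto simp: block_cuboid_def)
    have inter: "A i \<inter> A' i = {{}, {1..n i}}" if "i \<in> ?K" "S \<in> A i \<inter> A' i" "T \<in> A i \<inter> A' i" "S \<noteq> T" for i S T
      using almost_orthogonal_inter[OF ao[OF that(1) jj] Ai[OF that(1)] chain[OF that(1) jj(1) Ai(1)[OF that(1)]] _ that(2-4)]
        n4[OF that(1)] by simp
    have ends: "block n i X = {} \<and> block n i Y = {1..n i}"
      if i: "i \<in> ?K" and ne: "block n i X \<noteq> block n i Y" for i
    proof -
      have "block n i X \<subseteq> block n i Y"
        using block_mono_iff[OF sub(1), of Y] XY i by blast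
      then show ?thesis
        using inter[OF i blocks[OF i] ne] blocks[OF i] ne by auto
    qed
    have corner: "corner_pair r n X Y"
      using XY ends by (simp add: corner_pair_def)
    let ?I = "{i \<in> ?K. block n i X \<noteq> block n i Y}"
    have "exceptional_pair r n A (dd A) (tail (dd A) (A (dd A))) X Y"
      using Q[OF jj(1) A(1)] A(2) X Y corner unfolding chains_def by blast
    then have cA: "?I = M A" "(\<forall>i\<in>?K. {} \<notin> A i \<longrightarrow> card (A i) = 1) \<or>
       card (M A) = 1 \<and> dd A \<in> ?K \<and> {} \<notin> A (dd A) \<and> card (A (dd A)) = 2 \<and>
         (tail (dd A) (A (dd A)) \<in> A (dd A) \<longrightarrow> block n (dd A) X = tail (dd A) (A (dd A)))"
      by (simp_all only: exceptional_pair_def M_def)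
    have "exceptional_pair r n A' (dd A') (tail (dd A') (A' (dd A'))) X Y"
      using Q[OF jj(2) A'(1)] A'(2) X Y corner unfolding chains_def by blast
    then have cA': "?I = M A'" "(\<forall>i\<in>?K. {} \<notin> A' i \<longrightarrow> card (A' i) = 1) \<or>
       card (M A') = 1 \<and> dd A' \<in> ?K \<and> {} \<notin> A' (dd A') \<and> card (A' (dd A')) = 2 \<and>
         (tail (dd A') (A' (dd A')) \<in> A' (dd A') \<longrightarrow> block n (dd A') X = tail (dd A') (A' (dd A')))"
      by (simp_all only: exceptional_pair_def M_def)
    \<comment> \<open>In both colours the full factors are exactly those where \<open>X\<close> and
      \<open>Y\<close> differ; hence the designated factor agrees too.\<close>
    have MM: "M A = M A'" using cA(1) cA'(1) by simp
    then have empty_iff: "{} \<in> A i \<longleftrightarrow> {} \<in> A' i" if "i \<in> ?K" for i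
      using that unfolding M_def by blast
    have same_dd: "dd A = dd A'" using MM by (simp add: dd_def)
    \<comment> \<open>In a fixed factor all chain sizes have the parity of \<open>n i + 1\<close>,
      so a 1-element chain of one colour never faces a 2-element chain of the other. This excludes
      mixed kinds of clashes.\<close>
    have par: "even (card (A i)) \<longleftrightarrow> even (card (A' i))" if "i \<in> ?K" for i
      using parity[OF that jj(1) Ai(1)[OF that]] parity[OF that jj(2) Ai(2)[OF that]] by simp
    consider (everything) "M A = ?K"
      | (singletons) i where "i \<in> ?K" "{} \<notin> A i" "card (A i) = 1" "card (A' i) = 1"
      | (doubletons) "card (M A) = 1" "dd A \<in> ?K" "{} \<notin> A (dd A)" "card (A (dd A)) = 2" "card (A' (dd A)) = 2"
        "tail (dd A) (A (dd A)) \<in> A (dd A) \<longrightarrow> block n (dd A) X = tail (dd A) (A (dd A))"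
        "tail (dd A) (A' (dd A)) \<in> A' (dd A) \<longrightarrow> block n (dd A) X = tail (dd A) (A' (dd A))"
    proof (cases "M A = ?K")
      case False
      then obtain i where i: "i \<in> ?K" "{} \<notin> A i" unfolding M_def by blast
      have not_mixed: "\<not> (card (A l) = 1 \<and> card (A' l) = 2)" "\<not> (card (A l) = 2 \<and> card (A' l) = 1)"
        if "l \<in> ?K" for l
        using par[OF that] by auto
      from cA(2) show ?thesis
      proof
        assume one: "\<forall>i\<in>?K. {} \<notin> A i \<longrightarrow> card (A i) = 1"
        from cA'(2) show ?thesis
        proof
          assume "\<forall>i\<in>?K. {} \<notin> A' i \<longrightarrow> card (A' i) = 1"
          then show ?thesis using one i empty_iff singletons by blast
        next
          assume "card (M A') = 1 \<and> dd A' \<in> ?K \<and> {} \<notin> A' (dd A') \<and> card (A' (dd A')) = 2 \<and>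
            (tail (dd A') (A' (dd A')) \<in> A' (dd A') \<longrightarrow> block n (dd A') X = tail (dd A') (A' (dd A')))"
          then show ?thesis using one empty_iff not_mixed(1) by blast
        qed
      next
        assume two: "card (M A) = 1 \<and> dd A \<in> ?K \<and> {} \<notin> A (dd A) \<and> card (A (dd A)) = 2 \<and>
          (tail (dd A) (A (dd A)) \<in> A (dd A) \<longrightarrow> block n (dd A) X = tail (dd A) (A (dd A)))"
        from cA'(2) show ?thesis
        proof
          assume "\<forall>i\<in>?K. {} \<notin> A' i \<longrightarrow> card (A' i) = 1"
          then show ?thesis using two empty_iff not_mixed(2) by blast
        next
          assume "card (M A') = 1 \<and> dd A' \<in> ?K \<and> {} \<notin> A' (dd A') \<and> card (A' (dd A')) = 2 \<and>
            (tail (dd A') (A' (dd A')) \<in> A' (dd A') \<longrightarrow> block n (dd A') X = tail (dd A') (A' (dd A')))"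
          then show ?thesis using two same_dd doubletons by simp
        qed
      qed
    qed (rule everything)
    then show ?thesis
    proof cases
      case everything
      then have "block n i X = {}" "block n i Y = {1..n i}" if "i \<in> ?K" for i
        using cA(1) ends that by blast+
      then show ?thesis
        using block_eqI[OF sub(1), of "{}"] block_eqI[OF sub(2), of "{1..?N}"]
          block_empty block_all by simp
    next
      case (singletons i)
      \<comment> \<open>The two colours would share this 1-element chain, against goodness of an
        even factor.\<close>
      have "A i = {block n i X}" "A' i = {block n i X}"
        using blocks[OF singletons(1)] singletons(3,4) by (auto simp: card_1_singleton_iff)
      moreover have "even (n i)"
        using parity[OF singletons(1) jj(1) Ai(1)[OF singletons(1)]] singletons(3) by simp
      then have "disjoint_family_on (\<lambda>j. {C \<in> F i j. card C = 1}) {1..k}"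
        using assms(5) singletons(1) by (auto simp: good_def)
      then have "{C \<in> F i j. card C = 1} \<inter> {C \<in> F i j'. card C = 1} = {}"
        using jj by (simp add: disjoint_family_on_def)
      ultimately have False
        using Ai[OF singletons(1)] singletons(3) by auto
      then show ?thesis ..
    next
      case doubletons
      let ?d = "dd A"
      have g: "good_odd ?d"
        using dd[OF jj(1) A(1) doubletons(1-4)] by blast
      obtain v where v: "(tail ?d (A ?d), v) \<in> D ?d" "A ?d = {tail ?d (A ?d), v}"
        using tail[OF doubletons(2) g jj(1) Ai(1)[OF doubletons(2)] doubletons(4)] by blast
      obtain v' where v': "(tail ?d (A' ?d), v') \<in> D ?d" "A' ?d = {tail ?d (A' ?d), v'}"
        using tail[OF doubletons(2) g jj(2) Ai(2)[OF doubletons(2)] doubletons(5)] by blast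
      \<comment> \<open>Both tails equal the block of \<open>X\<close>, so two arcs leave the same
        vertex and must coincide. Then the chains are equal and share two points, which forces
        \<open>{}\<close> into a factor that is not full.\<close>
      have tails: "tail ?d (A ?d) = tail ?d (A' ?d)"
        using doubletons(6,7) v(2) v'(2) by (metis insertI1)
      have "v = v'"
        using orientation_tail_unique[OF D(1)[OF g] _ D(2)[OF g] v(1), of v'] v'(1) tails
          finite_two_element_chains[of "n ?d" k "F ?d"] assms(4) doubletons(2) by simp
      then have "A ?d = A' ?d" using v(2) v'(2) tails by simp
      moreover obtain S T where "S \<in> A ?d" "T \<in> A ?d" "S \<noteq> T"
        using doubletons(4) by (auto simp: card_2_iff)
      ultimately have "{} \<in> A ?d" using inter[OF doubletons(2), of S T] by auto
      then show ?thesis using doubletons(3) by blast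
    qed
  qed

  \<comment> \<open>Almost orthogonality and containment in cuboids\<close>
  have N: "?N \<ge> 1"
  proof -
    have "n 1 \<le> ?N" using assms(2) by (intro member_le_sum) auto
    then show ?thesis using n4[of 1] assms(2) by simp
  qed
  have "almost_orthogonal ?N (H j) (H j')" if jj: "j \<in> {1..k}" "j' \<in> {1..k}" "j \<noteq> j'" for j j'
    unfolding almost_orthogonal_def
  proof (intro ballI)
    fix C C' assume C: "C \<in> H j" "C' \<in> H j'"
    have sc: "symmetric_chain ?N C"
      using H_scd[OF jj(1)] C by (simp add: SCD_def)
    have two: "{X, Y} = {{}, {1..?N}}" if "X \<in> C \<inter> C'" "Y \<in> C \<inter> C'" "X \<noteq> Y" for X Y
    proof -
      have "X \<subset> Y \<or> Y \<subset> X"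
        using sc that by (auto simp: symmetric_chain_def chain_subset_def)
      then show ?thesis
        using corners[OF jj C] that by blast
    qed
    have "C \<subseteq> Pow {1..?N}"
      using sc by (simp add: symmetric_chain_def boolean_lattice_def)
    then have fin: "finite (C \<inter> C')" using finite_subset by blast
    show "if {{}, {1..?N}} \<subseteq> C \<and> {{}, {1..?N}} \<subseteq> C' then card (C \<inter> C') = 2 else card (C \<inter> C') \<le> 1"
    proof (cases "{{}, {1..?N}} \<subseteq> C \<and> {{}, {1..?N}} \<subseteq> C'")
      case True
      have "C \<inter> C' = {{}, {1..?N}}"
      proof (intro subset_antisym subsetI)
        fix Z assume "Z \<in> C \<inter> C'"
        then show "Z \<in> {{}, {1..?N}}" using two[of Z "{}"] True by blast
      qed (use True in blast)
      moreover have "card {{}, {1..?N}} = 2" using N by auto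
      ultimately show ?thesis using True by simp
    next
      case False
      have "X = Y" if "X \<in> C \<inter> C'" "Y \<in> C \<inter> C'" for X Y
      proof (rule ccontr)
        assume "X \<noteq> Y"
        then have "{X, Y} = {{}, {1..?N}}"
          by (rule two[OF that])
        moreover have "{X, Y} \<subseteq> C" "{X, Y} \<subseteq> C'"
          using that by blast+
        ultimately have "{{}, {1..?N}} \<subseteq> C" "{{}, {1..?N}} \<subseteq> C'"
          by (simp_all only:)
        then show False using False by blast
      qed
      then have "card (C \<inter> C') \<le> 1"
        using fin by (simp add: card_le_Suc0_iff_eq)
      then show ?thesis using False by auto
    qed
  qed
  then have "pairwise_almost_orthogonal_SCDs ?N k H"
    using H_scd by (simp add: pairwise_almost_orthogonal_SCDs_def)
  moreover have "\<exists>A. (\<forall>i\<in>?K. A i \<in> F i j) \<and> C \<subseteq> cuboid r n A" if jC: "j \<in> {1..k}" "C \<in> H j" for j C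
  proof -
    obtain A where A: "A \<in> ?P j" "C \<subseteq> block_cuboid r n A"
      using H_obtain[OF jC] by blast
    have "C \<subseteq> cuboid r n A"
      using A(2) block_cuboid_subset[of r n A] by (rule subset_trans)
    then show ?thesis
      using PiE_mem[OF A(1)] by blast
  qed
  ultimately show ?thesis by blast
qed

end
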